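(* Let $f(n)$ denote the maximum, over all Hegselmann-Krause systems with $n$ agents, of the earliest time at which the system has reached consensus or has two consecutive agents at distance greater than $1$. Then $f(1)=0$, $f(2)=1$, $f(3)=2$, $f(4)=5$, $f(5)=7$, $f(6)=9$, and $f(7)\ge 12$.
   Context: A Hegselmann-Krause system (HK system) $\mathcal{C}$ with $n$ agents on the real line is given by real initial opinions $x_1(0)\le x_2(0)\le\dots\le x_n(0)$. For all integers $t\ge 0$ the opinions are updated simultaneously by $$x_i(t+1)=\frac{1}{|\mathcal{N}_i(t)|}\sum_{j\in\mathcal{N}_i(t)}x_j(t),\qquad \mathcal{N}_i(t)=\{j\in\{1,\dots,n\} : |x_i(t)-x_j(t)|\le 1\}.$$ The ordering $x_1(t)\le\dots\le x_n(t)$ is preserved for all $t$. The system has reached consensus at time $t$ if $x_1(t)=x_2(t)=\dots=x_n(t)$. For an HK system $\mathcal{C}$ let $f(\mathcal{C})$ be the earliest time $t\in\{0,1,2,\dots\}$ such that $\mathcal{C}$ has reached consensus at time $t$ or $x_{i+1}(t)-x_i(t)>1$ for at least one index $i\in\{1,\dots,n-1\}$. Let $f(n)$ be the maximum of $f(\mathcal{C})$ over all HK systems $\mathcal{C}$ with $n$ agents. *)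

theory Defs
  imports Complex_Main "HOL-Library.Extended_Nat"
begin

text \<open>
  Opinions of agents \<open>1, \<dots>, n\<close> are functions \<open>nat \<Rightarrow> real\<close>; only the values on \<open>{1..n}\<close> matter,
  since neighbourhoods are restricted to \<open>{1..n}\<close>.
\<close>

definition hk_nbrs :: "nat \<Rightarrow> (nat \<Rightarrow> real) \<Rightarrow> nat \<Rightarrow> nat set" where
  "hk_nbrs n x i = {j \<in> {1..n}. \<bar>x i - x j\<bar> \<le> 1}"

definition hk_step :: "nat \<Rightarrow> (nat \<Rightarrow> real) \<Rightarrow> (nat \<Rightarrow> real)" where
  "hk_step n x = (\<lambda>i. (\<Sum>j\<in>hk_nbrs n x i. x j) / real (card (hk_nbrs n x i)))"

primrec hk_state :: "nat \<Rightarrow> (nat \<Rightarrow> real) \<Rightarrow> nat \<Rightarrow> (nat \<Rightarrow> real)" where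
  "hk_state n x0 0 = x0"
| "hk_state n x0 (Suc t) = hk_step n (hk_state n x0 t)"

definition hk_consensus :: "nat \<Rightarrow> (nat \<Rightarrow> real) \<Rightarrow> bool" where
  "hk_consensus n x \<longleftrightarrow> (\<forall>i\<in>{1..n}. \<forall>j\<in>{1..n}. x i = x j)"

definition hk_disconnected :: "nat \<Rightarrow> (nat \<Rightarrow> real) \<Rightarrow> bool" where
  "hk_disconnected n x \<longleftrightarrow> (\<exists>i\<in>{1..<n}. x (i + 1) - x i > 1)"

text \<open>
  The number \<open>f(C)\<close>, for the system \<open>C\<close> with \<open>n\<close> agents and initial opinions \<open>x0\<close>. It would be
  \<open>\<infinity>\<close> if no such time existed, as the infimum of the empty set in \<^typ>\<open>enat\<close> is \<open>\<infinity>\<close>.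
\<close>

definition hk_time :: "nat \<Rightarrow> (nat \<Rightarrow> real) \<Rightarrow> enat" where
  "hk_time n x0 =
     (INF t \<in> {t. hk_consensus n (hk_state n x0 t) \<or> hk_disconnected n (hk_state n x0 t)}. enat t)"

text \<open>
  \<open>hk_max_time n m\<close> means that the maximum \<open>f(n)\<close> exists and equals \<open>m\<close>. A relation is used because
  \<^const>\<open>Max\<close> is unspecified on infinite sets, and finiteness of the set of attained times is not
  evident from the definition.
\<close>

definition hk_max_time :: "nat \<Rightarrow> nat \<Rightarrow> bool" where
  "hk_max_time n m \<longleftrightarrow>
     (\<exists>x0. mono_on {1..n} x0 \<and> hk_time n x0 = enat m) \<and>
     (\<forall>x0. mono_on {1..n} x0 \<longrightarrow> hk_time n x0 \<le> enat m)"

end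

theory Submission
  imports Defs "HOL-Library.Sublist"
begin

text \<open>
  Call a state unsettled if it is connected and its diameter exceeds 1. A connected state of
  diameter at most 1 reaches consensus in one step, so \<open>f(n) \<le> k + 1\<close> as soon as no orbit is unsettled
  at all the times \<open>0, \<dots>, k\<close>.

  For \<open>3 \<le> n \<le> 6\<close> this is a finite problem. The neighbourhoods in a sorted state are given by its reach
  list, which records the rightmost neighbour of every agent, and an orbit is followed through the
  word of its successive reach lists. Along a fixed word the dynamics are linear, so a word is
  impossible precisely when some nonnegative combination of the inequalities that define its reach lists is
  contradictory, once all of them are expressed in the initial opinions. Listing all possible words
  of length \<open>k + 1\<close> would be long, but short words already decide: it suffices to remember at most the
  last five (for \<open>n = 6\<close>, four) reach lists. The tables below assign to some short words a rank, an upper bound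
  for the time at which an orbit that has just followed the word stops being unsettled. A rank is
  justified locally: every further reach list is either refuted by a certificate (the multipliers
  of a contradictory combination), or the extended word ends in a tabulated word of smaller rank
  (\<open>table_sound\<close>). The empty word has rank \<open>k\<close>, which is the upper bound (\<open>hk_time_le_table\<close>).

  The matching lower bounds, and \<open>f(7) \<ge> 12\<close>, come from explicit initial opinions on a lattice, simulated exactly
  in integers (\<open>hk_time_ge\<close>). For \<open>n = 7\<close> it remains to see that a maximum exists at all. Here an
  energy argument works for every \<open>n\<close>: the sum of the squared distances, each cut off at 1, drops by at least
  four times the sum of the squared moves (\<open>energy_hk_step\<close>), and in an unsettled state some agent
  moves at least \<open>1 / (4 n\<^sup>2)\<close> (\<open>ex_large_move\<close>); so an orbit is unsettled for a time that is bounded in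
  terms of \<open>n\<close>.
\<close>

section \<open>Averaging steps and when they end\<close>

lemma finite_hk_nbrs [simp]: "finite (hk_nbrs n x i)"
  by (simp add: hk_nbrs_def)

lemma self_in_hk_nbrs: "i \<in> {1..n} \<Longrightarrow> i \<in> hk_nbrs n x i"
  by (simp add: hk_nbrs_def)

lemma card_hk_nbrs_pos: "i \<in> {1..n} \<Longrightarrow> 0 < card (hk_nbrs n x i)"
  using self_in_hk_nbrs[of i n x] by (auto simp: card_gt_0_iff)

text \<open>
  In the double sum of \<open>f b - f a\<close> over \<open>A \<times> B\<close> the pairs with both entries in \<open>A \<inter> B\<close> cancel, and the remaining
  terms are nonnegative.
\<close>

lemma average_le_average:
  fixes f :: "'a \<Rightarrow> real"
  assumes fin: "finite A" "finite B" and ne: "A \<noteq> {}" "B \<noteq> {}"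
    and le: "\<And>a b. a \<in> A \<Longrightarrow> b \<in> B \<Longrightarrow> a \<notin> B \<or> b \<notin> A \<Longrightarrow> f a \<le> f b"
  shows "sum f A / card A \<le> sum f B / card B"
proof -
  define h where "h = (\<lambda>(a, b). f b - f a)"
  have swap: "(\<Sum>p\<in>(A \<inter> B) \<times> (A \<inter> B). h p) = - (\<Sum>p\<in>(A \<inter> B) \<times> (A \<inter> B). h p)"
  proof -
    have "(\<Sum>p\<in>(A \<inter> B) \<times> (A \<inter> B). h p) = (\<Sum>p\<in>(A \<inter> B) \<times> (A \<inter> B). h (prod.swap p))"
      by (rule sum.reindex_bij_witness[of _ prod.swap prod.swap]) auto
    also have "\<dots> = (\<Sum>p\<in>(A \<inter> B) \<times> (A \<inter> B). - h p)"
      by (intro sum.cong) (auto simp: h_def)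
    finally show ?thesis by (simp add: sum_negf)
  qed
  have "0 \<le> (\<Sum>p\<in>A \<times> B - (A \<inter> B) \<times> (A \<inter> B). h p)"
  proof (intro sum_nonneg)
    fix p assume "p \<in> A \<times> B - (A \<inter> B) \<times> (A \<inter> B)"
    then show "0 \<le> h p"
      using le[of "fst p" "snd p"] by (cases p) (auto simp: h_def)
  qed
  also have "\<dots> = (\<Sum>p\<in>A \<times> B. h p) - (\<Sum>p\<in>(A \<inter> B) \<times> (A \<inter> B). h p)"
    using fin by (intro sum_diff) auto
  also have "\<dots> = (\<Sum>p\<in>A \<times> B. h p)"
    using swap by simp
  also have "\<dots> = card A * sum f B - card B * sum f A"
    by (simp add: h_def sum.cartesian_product[symmetric] sum_subtractf sum_distrib_left)
  finally show ?thesis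
    using fin ne by (simp add: field_simps card_gt_0_iff)
qed

lemma mono_hk_step:
  assumes mono: "mono_on {1..n} x"
  shows "mono_on {1..n} (hk_step n x)"
proof (intro mono_onI)
  fix i k assume ik: "i \<in> {1..n}" "k \<in> {1..n}" "i \<le> k"
  then have "x i \<le> x k"
    using mono by (auto simp: mono_on_def)
  then show "hk_step n x i \<le> hk_step n x k"
    unfolding hk_step_def using self_in_hk_nbrs[OF ik(1)] self_in_hk_nbrs[OF ik(2)]
    by (intro average_le_average) (auto simp: hk_nbrs_def)
qed

lemma mono_hk_state: "mono_on {1..n} x \<Longrightarrow> mono_on {1..n} (hk_state n x t)"
  by (induction t) (simp_all only: hk_state.simps mono_hk_step)

lemma hk_state_Suc_shift: "hk_state n x (Suc t) = hk_state n (hk_step n x) t"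
  by (induction t) auto

definition unsettled :: "nat \<Rightarrow> (nat \<Rightarrow> real) \<Rightarrow> bool" where
  "unsettled n x \<longleftrightarrow> \<not> hk_disconnected n x \<and> 1 < x n - x 1"

lemma consensus_after_small_diameter:
  assumes mono: "mono_on {1..n} x" and diam: "x n - x 1 \<le> 1"
  shows "hk_consensus n (hk_step n x)"
proof -
  have bounds: "x 1 \<le> x j \<and> x j \<le> x n" if "j \<in> {1..n}" for j
    using that mono by (auto simp: mono_on_def)
  have "\<bar>x i - x j\<bar> \<le> 1" if "i \<in> {1..n}" "j \<in> {1..n}" for i j
    using bounds[OF that(1)] bounds[OF that(2)] diam by (simp add: abs_le_iff)
  then have all: "hk_nbrs n x i = {1..n}" if "i \<in> {1..n}" for i
    using that unfolding hk_nbrs_def by blast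
  show ?thesis
    unfolding hk_consensus_def by (simp add: hk_step_def all)
qed

lemma hk_time_le:
  assumes "hk_consensus n (hk_state n x t) \<or> hk_disconnected n (hk_state n x t)" "t \<le> m"
  shows "hk_time n x \<le> enat m"
  unfolding hk_time_def using assms by (intro INF_lower2[of t]) auto

lemma hk_time_le_Suc:
  assumes mono: "mono_on {1..n} x" and t: "t \<le> k" "\<not> unsettled n (hk_state n x t)"
  shows "hk_time n x \<le> enat (Suc k)"
proof (cases "hk_disconnected n (hk_state n x t)")
  case True
  then show ?thesis using t(1) by (intro hk_time_le[of _ _ t]) auto
next
  case False
  then have "hk_consensus n (hk_state n x (Suc t))"
    using t(2) mono_hk_state[OF mono]
    by (auto simp: unsettled_def not_less intro: consensus_after_small_diameter)
  then show ?thesis using t(1) by (intro hk_time_le[of _ _ "Suc t"]) auto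
qed

section \<open>Averaging as a linear map determined by a reach list\<close>

text \<open>
  Agents are numbered from 0 in lists, so agent \<open>Suc i\<close> is position \<open>i\<close>. The reach \<open>g ! i\<close> is the last
  position within distance 1 of position \<open>i\<close>.
\<close>

definition has_reach :: "nat \<Rightarrow> (nat \<Rightarrow> real) \<Rightarrow> nat list \<Rightarrow> bool" where
  "has_reach n x g \<longleftrightarrow> length g = n \<and> (\<forall>i<n. i \<le> g ! i \<and> g ! i < n) \<and>
     (\<forall>i<n. \<forall>j<n. i < j \<longrightarrow> (x (Suc j) - x (Suc i) \<le> 1 \<longleftrightarrow> j \<le> g ! i))"

lemma has_reach_iff:
  "has_reach n x g \<Longrightarrow> i < j \<Longrightarrow> j < n \<Longrightarrow> x (Suc j) - x (Suc i) \<le> 1 \<longleftrightarrow> j \<le> g ! i"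
  by (simp add: has_reach_def)

definition linked :: "nat list \<Rightarrow> nat \<Rightarrow> nat \<Rightarrow> bool" where
  "linked g i j = (if i \<le> j then j \<le> g ! i else i \<le> g ! j)"

definition nbr_lists :: "nat list \<Rightarrow> nat list list" where
  "nbr_lists g = map (\<lambda>i. filter (linked g i) [0..<length g]) [0..<length g]"

text \<open>
  If \<open>y\<close> is the state after \<open>x\<close>, then the functional with coefficients \<open>u\<close> at \<open>y\<close> is a functional at \<open>x\<close>: agent \<open>i\<close>
  hands an equal share of its coefficient to each of its neighbours, and by symmetry of the
  neighbour relation agent \<open>j\<close> collects the shares of its own neighbours. Coefficients stay integers by
  demanding that all the shares be exact.
\<close>

definition divisible :: "nat list list \<Rightarrow> int list \<Rightarrow> bool" where
  "divisible N u = list_all2 (\<lambda>ns a. a mod int (length ns) = 0) N u"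

definition shares :: "nat list list \<Rightarrow> int list \<Rightarrow> int list" where
  "shares N u = map2 (\<lambda>ns a. a div int (length ns)) N u"

definition pull_back :: "nat list list \<Rightarrow> int list \<Rightarrow> int list" where
  "pull_back N q = map (\<lambda>ns. sum_list (map ((!) q) ns)) N"

definition lin :: "(nat \<Rightarrow> real) \<Rightarrow> int list \<Rightarrow> real" where
  "lin x u = (\<Sum>i<length u. real_of_int (u ! i) * x (Suc i))"

lemma linked_sym: "linked g i j \<longleftrightarrow> linked g j i"
  by (auto simp: linked_def)

lemma hk_nbrs_eq:
  assumes mono: "mono_on {1..n} x" and g: "has_reach n x g" and i: "i < n"
  shows "hk_nbrs n x (Suc i) = Suc ` {j. j < n \<and> linked g i j}"
proof -
  have le: "x (Suc a) \<le> x (Suc b)" if "a \<le> b" "b < n" for a b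
    using mono that by (auto simp: mono_on_def)
  have near: "\<bar>x (Suc i) - x (Suc j)\<bar> \<le> 1 \<longleftrightarrow> linked g i j" if j: "j < n" for j
  proof (cases i j rule: linorder_cases)
    case less
    then show ?thesis
      using g le[of i j] i j by (auto simp: has_reach_def linked_def)
  next
    case equal
    then show ?thesis
      using g i by (auto simp: has_reach_def linked_def)
  next
    case greater
    then show ?thesis
      using g le[of j i] i j by (auto simp: has_reach_def linked_def)
  qed
  show ?thesis
  proof (intro set_eqI iffI)
    fix k assume "k \<in> hk_nbrs n x (Suc i)"
    then show "k \<in> Suc ` {j. j < n \<and> linked g i j}"
      using near[of "k - 1"] by (auto simp: hk_nbrs_def intro!: image_eqI[of _ _ "k - 1"])
  next
    fix k assume "k \<in> Suc ` {j. j < n \<and> linked g i j}"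
    then show "k \<in> hk_nbrs n x (Suc i)"
      using near by (auto simp: hk_nbrs_def)
  qed
qed

lemma sum_list_filter_upt:
  "sum_list (map f (filter P [0..<n])) = (\<Sum>i | i < n \<and> P i. f i)"
  by (simp add: sum_list_distinct_conv_sum_set Int_def conj_commute)

lemma length_filter_upt: "length (filter P [0..<n]) = card {i. i < n \<and> P i}"
  by (subst distinct_card[symmetric]) (auto simp: conj_commute)

lemma lin_pull_back:
  assumes mono: "mono_on {1..n} x" and g: "has_reach n x g" and u: "length u = n"
    and dvd: "divisible (nbr_lists g) u"
  shows "lin x (pull_back (nbr_lists g) (shares (nbr_lists g) u)) = lin (hk_step n x) u"
proof -
  define q where "q = shares (nbr_lists g) u"
  have len: "length g = n" using g by (simp add: has_reach_def)
  have lenN: "length (nbr_lists g) = n" by (simp add: nbr_lists_def len)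
  have Nth: "nbr_lists g ! i = filter (linked g i) [0..<n]" if "i < n" for i
    using that by (simp add: nbr_lists_def len)
  have q: "real_of_int (u ! i) / card (hk_nbrs n x (Suc i)) = q ! i" if i: "i < n" for i
  proof -
    have c: "card (hk_nbrs n x (Suc i)) = length (nbr_lists g ! i)"
      using hk_nbrs_eq[OF mono g i] by (simp add: Nth i length_filter_upt card_image)
    have "u ! i mod int (length (nbr_lists g ! i)) = 0"
      using dvd i by (simp add: divisible_def list_all2_conv_all_nth lenN)
    then have "int (length (nbr_lists g ! i)) * (u ! i div int (length (nbr_lists g ! i))) = u ! i"
      by (simp add: mod_0_imp_dvd)
    moreover have "q ! i = u ! i div int (length (nbr_lists g ! i))"
      using i by (simp add: q_def shares_def lenN u)
    ultimately have "int (length (nbr_lists g ! i)) * q ! i = u ! i"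
      by simp
    then have "real (length (nbr_lists g ! i)) * q ! i = u ! i"
      by (metis of_int_mult of_int_of_nat_eq)
    moreover have "length (nbr_lists g ! i) > 0"
      using card_hk_nbrs_pos[of "Suc i" n x] i c by simp
    ultimately show ?thesis by (simp add: c field_simps)
  qed
  have "lin (hk_step n x) u = (\<Sum>i<n. \<Sum>j | j < n \<and> linked g i j. q ! i * x (Suc j))"
    unfolding lin_def u
  proof (intro sum.cong refl)
    fix i assume "i \<in> {..<n}"
    then have i: "i < n" by simp
    have "hk_step n x (Suc i) = (\<Sum>j | j < n \<and> linked g i j. x (Suc j)) / card (hk_nbrs n x (Suc i))"
      unfolding hk_step_def by (subst hk_nbrs_eq[OF mono g i]) (simp add: sum.reindex)
    then show "u ! i * hk_step n x (Suc i) = (\<Sum>j | j < n \<and> linked g i j. q ! i * x (Suc j))"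
      by (simp add: sum_distrib_left sum_divide_distrib flip: q[OF i])
  qed
  also have "\<dots> = (\<Sum>j<n. \<Sum>i | i < n \<and> linked g j i. q ! i * x (Suc j))"
    using sum.swap_restrict[of "{..<n}" "{..<n}" "\<lambda>i j. q ! i * x (Suc j)" "linked g"]
    by (simp add: linked_sym[of g])
  also have "\<dots> = lin x (pull_back (nbr_lists g) q)"
    unfolding lin_def pull_back_def
    by (auto simp: lenN Nth sum_list_filter_upt sum_distrib_right intro!: sum.cong)
  finally show ?thesis by (simp add: q_def)
qed

section \<open>Certificates that a sequence of reach lists is impossible\<close>

type_synonym terms = "(nat \<times> nat \<times> int) list"

text \<open>
  Words are stored with the latest reach list first, so that forgetting the remote past means passing to a
  prefix. In \<open>trail n w x\<close> the state \<open>x\<close> is the one reached after the last letter of the orbit's word, and its own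
  reach list does not belong to \<open>w\<close>.
\<close>

fun trail :: "nat \<Rightarrow> nat list list \<Rightarrow> (nat \<Rightarrow> real) \<Rightarrow> bool" where
  "trail n [] x = mono_on {1..n} x"
| "trail n (g # w) x = (\<exists>y. trail n w y \<and> has_reach n y g \<and> x = hk_step n y)"

text \<open>
  The term \<open>(i, j, c)\<close> stands for the inequality \<open>c * (x\<^sub>j - x\<^sub>i - \<epsilon>) \<ge> 0\<close>, where \<open>\<epsilon> = 1\<close> if \<open>i < j\<close> and \<open>\<epsilon> = 0\<close> if
  \<open>j < i\<close>. Whether \<open>x\<^sub>j - x\<^sub>i - \<epsilon>\<close> is positive is decided by the reach list: if \<open>j\<close> is within the reach of \<open>i\<close>, in
  particular if \<open>j < i\<close>, then it is not, and \<open>c\<close> has to be nonpositive; otherwise \<open>c\<close> has to be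
  nonnegative, and the inequality is strict for \<open>c > 0\<close>.
\<close>

definition term_holds :: "nat list \<Rightarrow> nat \<times> nat \<times> int \<Rightarrow> bool" where
  "term_holds g = (\<lambda>(i, j, c). i < length g \<and> j < length g \<and> i \<noteq> j \<and>
     (if j \<le> g ! i then c \<le> 0 else 0 \<le> c))"

fun add_terms :: "terms \<Rightarrow> int list \<Rightarrow> int list" where
  "add_terms [] u = u"
| "add_terms ((i, j, c) # ts) u = add_terms ts (u[i := u ! i - c, j := u ! j + c])"

definition offset :: "terms \<Rightarrow> int" where
  "offset ts = sum_list (map (\<lambda>(i, j, c). if i < j then c else 0) ts)"

definition has_strict :: "terms \<Rightarrow> bool" where
  "has_strict ts = list_ex (\<lambda>(i, j, c). i < j \<and> 0 < c) ts"

text \<open>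
  A certificate holds one list of terms for each time, the latest time first. Starting from the
  functional 0, the terms of the current time are added and the result is pulled back to the previous
  state. If all coefficients vanish at the initial time, then the variables have cancelled from the
  sum of all the inequalities, and what remains is a comparison of constants.
\<close>

fun balanced :: "nat list list list \<Rightarrow> int list \<Rightarrow> terms list \<Rightarrow> bool" where
  "balanced Ns u [] = False"
| "balanced [] u (c # cs) = (cs = [] \<and> list_all (\<lambda>a. a = 0) (add_terms c u))"
| "balanced (N # Ns) u (c # cs) =
     (divisible N (add_terms c u) \<and> balanced Ns (pull_back N (shares N (add_terms c u))) cs)"

definition cert_ok :: "nat \<Rightarrow> nat list list \<Rightarrow> nat list list list \<Rightarrow> terms list \<Rightarrow> bool" where
  "cert_ok n w Ns cs \<longleftrightarrow> balanced Ns (replicate n 0) cs \<and>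
     0 \<le> sum_list (map offset cs) \<and> list_ex has_strict cs \<and>
     list_all2 (\<lambda>g c. list_all (term_holds g) c) w (tl cs)"

lemma trail_mono: "trail n w x \<Longrightarrow> mono_on {1..n} x"
  by (induction w arbitrary: x) (simp, metis trail.simps(2) mono_hk_step)

lemma trail_prefix: "trail n w x \<Longrightarrow> prefix p w \<Longrightarrow> trail n p x"
proof (induction w arbitrary: x p)
  case Nil
  then show ?case by simp
next
  case (Cons g w)
  show ?case
  proof (cases p)
    case Nil
    then show ?thesis using trail_mono[OF Cons.prems(1)] by simp
  next
    case (Cons h p')
    then show ?thesis using Cons.prems Cons.IH by auto
  qed
qed

lemma lin_update:
  assumes "i < length u" "j < length u" "i \<noteq> j"
  shows "lin x (u[i := u ! i - c, j := u ! j + c]) = lin x u + c * (x (Suc j) - x (Suc i))"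
proof -
  have "lin x (u[k := u ! k + d]) = lin x u + d * x (Suc k)" if "k < length u" for u k d
  proof -
    have "lin x (u[k := u ! k + d]) - lin x u = (\<Sum>i<length u. if i = k then d * x (Suc k) else 0)"
      unfolding lin_def length_list_update sum_subtractf[symmetric]
      by (intro sum.cong refl) (auto simp: nth_list_update algebra_simps)
    then show ?thesis using that by simp
  qed
  from this[of j "u[i := u ! i - c]" c] this[of i u "- c"] assms show ?thesis
    by (simp add: algebra_simps)
qed

lemma lin_add_terms:
  assumes "mono_on {1..n} x" "has_reach n x g" "list_all (term_holds g) ts" "length u = n"
  shows "length (add_terms ts u) = n \<and> lin x u + offset ts \<le> lin x (add_terms ts u) \<and>
    (has_strict ts \<longrightarrow> lin x u + offset ts < lin x (add_terms ts u))"
  using assms(3,4)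
proof (induction ts u rule: add_terms.induct)
  case (1 u)
  then show ?case by (simp add: offset_def has_strict_def)
next
  case (2 i j c ts u)
  have t: "i < n" "j < n" "i \<noteq> j" "if j \<le> g ! i then c \<le> 0 else 0 \<le> c"
    using 2(2) assms(2) by (auto simp: term_holds_def has_reach_def)
  define d where "d = x (Suc j) - x (Suc i)"
  define e where "e = real_of_int (if i < j then c else 0)"
  have d: "e \<le> c * d" "i < j \<Longrightarrow> 0 < c \<Longrightarrow> e < c * d"
  proof -
    show "e \<le> c * d"
    proof (cases "i < j")
      case True
      then have "d \<le> 1 \<longleftrightarrow> j \<le> g ! i"
        using assms(2) t by (auto simp: has_reach_def d_def)
      then have "0 \<le> c * (d - 1)"
        using t(4) by (cases "j \<le> g ! i") (auto intro: mult_nonpos_nonpos)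
      then show ?thesis using True by (simp add: e_def algebra_simps)
    next
      case False
      then have "i \<le> g ! i" "j < i" using assms(2) t by (auto simp: has_reach_def)
      then have "c \<le> 0" "d \<le> 0"
        using t assms(1) by (auto simp: d_def mono_on_def split: if_splits)
      then show ?thesis using False by (simp add: e_def mult_nonpos_nonpos)
    qed
    assume "i < j" "0 < c"
    with t have "\<not> j \<le> g ! i" by auto
    moreover have "d \<le> 1 \<longleftrightarrow> j \<le> g ! i"
      using assms(2) t \<open>i < j\<close> by (auto simp: has_reach_def d_def)
    ultimately have "1 < d" by simp
    then show "e < c * d" using \<open>i < j\<close> \<open>0 < c\<close> by (simp add: e_def)
  qed
  define u' where "u' = u[i := u ! i - c, j := u ! j + c]"
  have u': "lin x u' = lin x u + c * d"
    using lin_update[of i u j x c] t 2(3) by (simp add: d_def u'_def)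
  have IH: "length (add_terms ts u') = n \<and> lin x u' + offset ts \<le> lin x (add_terms ts u') \<and>
    (has_strict ts \<longrightarrow> lin x u' + offset ts < lin x (add_terms ts u'))"
    using 2 by (simp add: u'_def)
  have off: "real_of_int (offset ((i, j, c) # ts)) = e + offset ts"
    by (simp add: offset_def e_def)
  have "lin x u + offset ((i, j, c) # ts) < lin x (add_terms ts u')" if "has_strict ((i, j, c) # ts)"
  proof (cases "has_strict ts")
    case True
    then show ?thesis using IH u' off d(1) by linarith
  next
    case False
    then have "e < c * d" using that d(2) by (simp add: has_strict_def)
    then show ?thesis using IH u' off by linarith
  qed
  moreover have "lin x u + offset ((i, j, c) # ts) \<le> lin x (add_terms ts u')"
    using IH u' off d(1) by linarith
  ultimately show ?case
    using IH by (simp add: u'_def)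
qed

text \<open>
  Pulling back preserves the value of a functional along the orbit, and adding terms can only
  increase it by at least their offset; since it ends at 0, it began at minus the total offset at most.
\<close>

lemma balanced_sound:
  assumes "trail n w x" "has_reach n x g" "list_all (term_holds g) c"
    "list_all2 (\<lambda>g c. list_all (term_holds g) c) w cs"
    "balanced (map nbr_lists w) u (c # cs)" "length u = n"
  shows "lin x u + sum_list (map offset (c # cs)) \<le> 0 \<and>
    (list_ex has_strict (c # cs) \<longrightarrow> lin x u + sum_list (map offset (c # cs)) < 0)"
  using assms
proof (induction w arbitrary: x g c cs u)
  case Nil
  then have "lin x (add_terms c u) = 0"
    by (auto simp: lin_def list_all_length)
  moreover have "cs = []" using Nil by simp
  ultimately show ?case
    using lin_add_terms[of n x g c u] Nil by auto
next
  case (Cons h w)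
  from Cons.prems(4) obtain c' cs' where cs: "cs = c' # cs'"
    by (cases cs) auto
  from Cons.prems(1) obtain y where y: "trail n w y" "has_reach n y h" "x = hk_step n y"
    by auto
  define u' where "u' = pull_back (nbr_lists h) (shares (nbr_lists h) (add_terms c u))"
  note terms = lin_add_terms[OF trail_mono[OF Cons.prems(1)] Cons.prems(2,3,6)]
  have "length h = n" using y(2) by (simp add: has_reach_def)
  then have "length u' = n" by (simp add: u'_def pull_back_def nbr_lists_def)
  moreover have "balanced (map nbr_lists w) u' (c' # cs')"
    using Cons.prems(5) by (simp add: cs u'_def)
  ultimately have IH: "lin y u' + sum_list (map offset (c' # cs')) \<le> 0 \<and>
    (list_ex has_strict (c' # cs') \<longrightarrow> lin y u' + sum_list (map offset (c' # cs')) < 0)"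
    using Cons.prems(4) y by (intro Cons.IH[of y h]) (auto simp: cs)
  have "lin y u' = lin x (add_terms c u)"
    unfolding u'_def y(3) using y terms Cons.prems(5)
    by (intro lin_pull_back[OF trail_mono[OF y(1)]]) auto
  with IH terms show ?case
    by (auto simp: cs)
qed

lemma cert_sound:
  assumes "cert_ok n w (map nbr_lists w) cs" "trail n w x" "has_reach n x g"
    "list_all (term_holds g) (hd cs)"
  shows False
proof (cases cs)
  case Nil
  then show ?thesis using assms(1) by (simp add: cert_ok_def)
next
  case (Cons c cs')
  have "lin x (replicate n 0) = 0" by (simp add: lin_def)
  then show ?thesis
    using balanced_sound[OF assms(2,3), of c cs' "replicate n 0"] assms(1,4)
    by (auto simp: cert_ok_def Cons)
qed

section \<open>Tables of forbidden continuations\<close>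

text \<open>
  In a sorted connected state the reaches increase weakly and, except for the last agent, lie to
  the right of the agent itself. In \<open>staircases n k m\<close> the reaches of the last \<open>k\<close> agents are enumerated,
  \<open>m\<close> being a lower bound for them. The reach lists of unsettled states are those among them in which the
  first agent does not see the last one.
\<close>

fun staircases :: "nat \<Rightarrow> nat \<Rightarrow> nat \<Rightarrow> nat list list" where
  "staircases n 0 m = [[]]"
| "staircases n (Suc k) m =
     concat (map (\<lambda>v. map ((#) v) (staircases n k v)) [max m (if k = 0 then n - 1 else n - k)..<n])"

definition reach_lists :: "nat \<Rightarrow> nat list list" where
  "reach_lists n = filter (\<lambda>g. hd g < n - 1) (staircases n n 0)"

lemma in_staircases:
  "length h = k \<Longrightarrow> sorted (m # h) \<Longrightarrow> (\<And>i. i < k \<Longrightarrow> h ! i < n) \<Longrightarrow>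
   (\<And>i. Suc i < k \<Longrightarrow> n - k + i < h ! i) \<Longrightarrow> (\<And>i. Suc i = k \<Longrightarrow> h ! i = n - 1) \<Longrightarrow> k \<le> n \<Longrightarrow>
   h \<in> set (staircases n k m)"
proof (induction k arbitrary: h m)
  case 0
  then show ?case by simp
next
  case (Suc k)
  obtain v h' where h: "h = v # h'"
    using Suc.prems(1) by (cases h) auto
  have "h' \<in> set (staircases n k v)"
  proof (rule Suc.IH)
    show "n - k + i < h' ! i" if "Suc i < k" for i
      using Suc.prems(4)[of "Suc i"] that Suc.prems(6) by (simp add: h)
    show "h' ! i < n" if "i < k" for i
      using Suc.prems(3)[of "Suc i"] that by (simp add: h)
    show "h' ! i = n - 1" if "Suc i = k" for i
      using Suc.prems(5)[of "Suc i"] that by (auto simp: h)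
    show "length h' = k" "sorted (v # h')" "k \<le> n"
      using Suc.prems(1,2,6) by (simp_all add: h)
  qed
  moreover have "(if k = 0 then n - 1 else n - k) \<le> v"
    using Suc.prems(4)[of 0] Suc.prems(5)[of 0] Suc.prems(6) by (cases k) (simp_all add: h)
  moreover have "m \<le> v" "v < n"
    using Suc.prems(2) Suc.prems(3)[of 0] by (simp_all add: h)
  ultimately have v: "v \<in> set [max m (if k = 0 then n - 1 else n - k)..<n]"
    and "v # h' \<in> set (map ((#) v) (staircases n k v))"
    by simp_all
  then show ?case
    unfolding h staircases.simps set_concat set_map by (intro UN_I[OF imageI[OF v]]) simp
qed

lemma ex_reach_list:
  assumes mono: "mono_on {1..n} x" and act: "unsettled n x" and n: "1 \<le> n"
  shows "\<exists>g\<in>set (reach_lists n). has_reach n x g"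
proof -
  define R where "R = (\<lambda>i. {j. i \<le> j \<and> j < n \<and> x (Suc j) - x (Suc i) \<le> 1})"
  define g where "g = map (\<lambda>i. Max (R i)) [0..<n]"
  have fin: "finite (R i)" for i by (simp add: R_def)
  have i_in: "i \<in> R i" if "i < n" for i using that by (simp add: R_def)
  have le: "x (Suc a) \<le> x (Suc b)" if "a \<le> b" "b < n" for a b
    using mono that by (auto simp: mono_on_def)
  have gi: "g ! i = Max (R i)" if "i < n" for i using that by (simp add: g_def)
  have g_in: "g ! i \<in> R i" if "i < n" for i
    unfolding gi[OF that] using fin i_in[OF that] by (intro Max_in) auto
  have desc: "has_reach n x g"
    unfolding has_reach_def
  proof (intro conjI allI impI)
    fix i j assume ij: "i < n" "j < n" "i < j"
    show "x (Suc j) - x (Suc i) \<le> 1 \<longleftrightarrow> j \<le> g ! i"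
    proof
      assume "x (Suc j) - x (Suc i) \<le> 1"
      then show "j \<le> g ! i"
        unfolding gi[OF ij(1)] using ij by (intro Max_ge fin) (simp add: R_def)
    next
      assume "j \<le> g ! i"
      with g_in[OF ij(1)] le[of j "g ! i"] show "x (Suc j) - x (Suc i) \<le> 1"
        by (simp add: R_def)
    qed
  qed (use g_in in \<open>auto simp: R_def g_def\<close>)
  have next_le: "i < g ! i" if "Suc i < n" for i
  proof -
    have "x (Suc (Suc i)) - x (Suc i) \<le> 1"
      using act that by (force simp: unsettled_def hk_disconnected_def)
    then show ?thesis using desc that by (auto simp: has_reach_def Suc_le_eq)
  qed
  have "g \<in> set (staircases n n 0)"
  proof (rule in_staircases)
    have "g ! i \<le> g ! j" if "i \<le> j" "j < n" for i j
    proof (cases "g ! i \<le> j")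
      case True
      then show ?thesis using g_in[OF that(2)] by (auto simp: R_def)
    next
      case False
      then have "g ! i \<in> R j"
        using g_in[of i] le[of i j] that by (auto simp: R_def)
      then show ?thesis using gi[OF that(2)] fin by simp
    qed
    then show "sorted (0 # g)"
      by (auto simp: sorted_iff_nth_mono g_def)
    show "g ! i = n - 1" if "Suc i = n" for i
      using g_in[of i] that by (auto simp: R_def)
  qed (use g_in next_le in \<open>auto simp: R_def g_def\<close>)
  moreover have "hd g < n - 1"
  proof (cases "n = 1")
    case True
    then show ?thesis using act by (simp add: unsettled_def)
  next
    case False
    with n have n2: "0 < n - 1" "n - 1 < n" "Suc (n - 1) = n" by auto
    from has_reach_iff[OF desc n2(1,2)] have "\<not> n - 1 \<le> g ! 0"
      using act n2 by (simp add: unsettled_def)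
    moreover have "g \<noteq> []" using n by (simp add: g_def)
    ultimately show ?thesis by (simp add: hd_conv_nth)
  qed
  ultimately show ?thesis using desc by (auto simp: reach_lists_def)
qed

text \<open>
  An entry consists of a word, its rank and the certificates that refute further reach lists after the word.
\<close>

type_synonym entry = "nat list list \<times> nat \<times> terms list list"

definition ranked_next :: "(nat list list \<times> nat) list \<Rightarrow> nat list list \<Rightarrow> nat \<Rightarrow> nat list list" where
  "ranked_next ranks w k =
     map (\<lambda>(p, _). hd p) (filter (\<lambda>(p, k'). p \<noteq> [] \<and> k' < k \<and> prefix (tl p) w) ranks)"

text \<open>
  Only the first component of a certificate, the terms at the latest time, concerns the new reach list;
  one certificate can therefore refute many reach lists at once. The conditional is a disjunction that the
  simplifier evaluates lazily.
\<close>

definition handled :: "nat list list \<Rightarrow> terms list list \<Rightarrow> nat list \<Rightarrow> bool" where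
  "handled gs certs g =
     (if list_ex (\<lambda>cs. list_all (term_holds g) (hd cs)) certs then True else g \<in> set gs)"

definition entry_ok :: "nat \<Rightarrow> nat list list \<Rightarrow> (nat list list \<times> nat) list \<Rightarrow> entry \<Rightarrow> bool" where
  "entry_ok n G ranks = (\<lambda>(w, k, certs).
     list_all (cert_ok n w (map nbr_lists w)) certs \<and>
     list_all (handled (ranked_next ranks w k) certs) G)"

definition ranks :: "entry list \<Rightarrow> (nat list list \<times> nat) list" where
  "ranks tab = map (\<lambda>(w, k, _). (w, k)) tab"

definition table_ok :: "nat \<Rightarrow> entry list \<Rightarrow> bool" where
  "table_ok n tab = list_all (entry_ok n (reach_lists n) (ranks tab)) tab"

text \<open>
  By induction on the rank. If \<open>x\<close> is still unsettled, its reach list extends the word; as no certificate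
  can apply to it, the extended word begins with a word of smaller rank, and the next state has
  followed this word.
\<close>

lemma table_sound:
  assumes ok: "table_ok n tab" and n: "1 \<le> n"
  shows "(w, k, certs) \<in> set tab \<Longrightarrow> trail n w x \<Longrightarrow> \<exists>t\<le>k. \<not> unsettled n (hk_state n x t)"
proof (induction k arbitrary: w certs x rule: less_induct)
  case (less k)
  show ?case
  proof (cases "unsettled n x")
    case False
    then show ?thesis by (intro exI[of _ 0]) simp
  next
    case True
    with ex_reach_list[OF trail_mono[OF less.prems(2)] True n]
    obtain g where g: "g \<in> set (reach_lists n)" "has_reach n x g" by blast
    have entry: "entry_ok n (reach_lists n) (ranks tab) (w, k, certs)"
      using ok less.prems(1) by (auto simp: table_ok_def list_all_iff)
    have "g \<in> set (ranked_next (ranks tab) w k)"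
    proof (rule ccontr)
      assume "g \<notin> set (ranked_next (ranks tab) w k)"
      then obtain cs where cs: "cs \<in> set certs" "list_all (term_holds g) (hd cs)"
        using entry g(1) by (auto simp: entry_ok_def handled_def list_all_iff list_ex_iff split: if_splits)
      then have "cert_ok n w (map nbr_lists w) cs"
        using entry by (simp add: entry_ok_def list_all_iff)
      then show False
        using less.prems(2) g(2) cs(2) by (rule cert_sound)
    qed
    then obtain p k' certs' where p: "(p, k', certs') \<in> set tab" "p \<noteq> []" "k' < k" "prefix (tl p) w" "hd p = g"
      by (auto simp: ranked_next_def ranks_def)
    have "trail n (g # w) (hk_step n x)" using less.prems(2) g(2) by auto
    moreover have "prefix p (g # w)" using p by (cases p) auto
    ultimately obtain t where "t \<le> k'" "\<not> unsettled n (hk_state n (hk_step n x) t)"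
      using less.IH[OF p(3,1)] trail_prefix by blast
    then show ?thesis
      using p(3) by (intro exI[of _ "Suc t"]) (simp only: hk_state_Suc_shift, simp)
  qed
qed

lemma hk_time_le_table:
  assumes "table_ok n tab" "1 \<le> n" "([], k, certs) \<in> set tab" "mono_on {1..n} x"
  shows "hk_time n x \<le> enat (Suc k)"
proof -
  obtain t where "t \<le> k" "\<not> unsettled n (hk_state n x t)"
    using table_sound[OF assms(1-3), of x] assms(4) unfolding trail.simps by blast
  then show ?thesis by (intro hk_time_le_Suc[OF assms(4)])
qed

section \<open>A bound for every number of agents\<close>

definition energy :: "nat \<Rightarrow> (nat \<Rightarrow> real) \<Rightarrow> real" where
  "energy n x = (\<Sum>i\<in>{1..n}. \<Sum>j\<in>{1..n}. min 1 ((x i - x j)\<^sup>2))"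

lemma energy_nonneg: "0 \<le> energy n x"
  by (auto simp: energy_def intro!: sum_nonneg)

lemma energy_le: "energy n x \<le> (real n)\<^sup>2"
proof -
  have "energy n x \<le> (\<Sum>i\<in>{1..n}. \<Sum>j\<in>{1..n}. 1)"
    unfolding energy_def by (intro sum_mono) auto
  then show ?thesis by (simp add: power2_eq_square)
qed

lemma sum_move_eq:
  assumes "i \<in> {1..n}"
  shows "card (hk_nbrs n x i) * (hk_step n x i - x i) = (\<Sum>j\<in>hk_nbrs n x i. x j - x i)"
  using card_hk_nbrs_pos[OF assms, of x]
  by (simp add: hk_step_def sum_subtractf right_diff_distrib)

text \<open>
  Write \<open>u\<close> for the vector of moves and let all sums range over ordered pairs of neighbours in the
  state before the step. Keeping these pairs and the value 1 for all the others can only overestimate the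
  energy after the step. Because the neighbours of \<open>i\<close> have mean \<open>x\<^sub>i + u\<^sub>i\<close>, the terms that are linear
  in \<open>x\<close> cancel, and the decrease is at least the sum of \<open>(u\<^sub>i + u\<^sub>j)\<^sup>2\<close>; the pairs \<open>(i, i)\<close> alone contribute
  \<open>4 u\<^sub>i\<^sup>2\<close> each.
\<close>

lemma energy_hk_step:
  "energy n (hk_step n x) + 4 * (\<Sum>i\<in>{1..n}. (hk_step n x i - x i)\<^sup>2) \<le> energy n x"
proof -
  define I where "I = {1..n}"
  define y where "y = hk_step n x"
  define u where "u = (\<lambda>i. y i - x i)"
  define W where "W = (\<lambda>i j. if \<bar>x i - x j\<bar> \<le> 1 then 1 else 0 :: real)"
  have fin: "finite I" by (simp add: I_def)
  have W_sym: "W i j = W j i" for i j by (simp add: W_def abs_minus_commute)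
  have W_sum: "(\<Sum>j\<in>I. W i j * f j) = (\<Sum>j\<in>hk_nbrs n x i. f j)" for i f
    unfolding W_def hk_nbrs_def I_def
    by (simp add: if_distrib[of "\<lambda>c. c * _"] sum.inter_filter[symmetric] cong: if_cong)
  have balance: "(\<Sum>j\<in>I. W i j * (2 * u i * (x j - x i - u i))) = 0" if "i \<in> I" for i
  proof -
    have "(\<Sum>j\<in>hk_nbrs n x i. x j - x i - u i) = 0"
      using sum_move_eq[of i n x] that by (subst sum_subtractf) (simp add: u_def y_def I_def)
    then show ?thesis
      by (simp add: W_sum flip: sum_distrib_left)
  qed
  have "energy n y \<le> (\<Sum>i\<in>I. \<Sum>j\<in>I. W i j * (y i - y j)\<^sup>2 + (1 - W i j))"
    unfolding energy_def I_def by (intro sum_mono) (auto simp: W_def)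
  also have "\<dots> = (\<Sum>i\<in>I. \<Sum>j\<in>I. (W i j * (x i - x j)\<^sup>2 + (1 - W i j))
      - W i j * (2 * u i * (x j - x i - u i)) - W j i * (2 * u j * (x i - x j - u j)) - W i j * (u i + u j)\<^sup>2)"
    by (intro sum.cong refl) (simp add: W_sym[of _ _] u_def power2_eq_square algebra_simps)
  also have "\<dots> = (\<Sum>i\<in>I. \<Sum>j\<in>I. W i j * (x i - x j)\<^sup>2 + (1 - W i j))
      - (\<Sum>i\<in>I. \<Sum>j\<in>I. W i j * (2 * u i * (x j - x i - u i)))
      - (\<Sum>i\<in>I. \<Sum>j\<in>I. W j i * (2 * u j * (x i - x j - u j)))
      - (\<Sum>i\<in>I. \<Sum>j\<in>I. W i j * (u i + u j)\<^sup>2)"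
    by (simp only: sum.distrib sum_subtractf)
  also have "(\<Sum>i\<in>I. \<Sum>j\<in>I. W j i * (2 * u j * (x i - x j - u j))) = 0"
    by (subst sum.swap) (simp add: balance)
  also have "(\<Sum>i\<in>I. \<Sum>j\<in>I. W i j * (2 * u i * (x j - x i - u i))) = 0"
    by (simp add: balance)
  also have "(\<Sum>i\<in>I. \<Sum>j\<in>I. W i j * (x i - x j)\<^sup>2 + (1 - W i j)) = energy n x"
    unfolding energy_def I_def
  proof (intro sum.cong refl)
    fix i j
    have "(x i - x j)\<^sup>2 \<le> 1 \<longleftrightarrow> \<bar>x i - x j\<bar> \<le> 1"
      by (simp add: abs_square_le_1)
    then show "W i j * (x i - x j)\<^sup>2 + (1 - W i j) = min 1 ((x i - x j)\<^sup>2)"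
      by (auto simp: W_def min_def)
  qed
  finally have "energy n y + (\<Sum>i\<in>I. \<Sum>j\<in>I. W i j * (u i + u j)\<^sup>2) \<le> energy n x"
    by simp
  moreover have "4 * (\<Sum>i\<in>I. (u i)\<^sup>2) \<le> (\<Sum>i\<in>I. \<Sum>j\<in>I. W i j * (u i + u j)\<^sup>2)"
    unfolding sum_distrib_left
  proof (intro sum_mono)
    fix i assume "i \<in> I"
    then have "W i i * (u i + u i)\<^sup>2 \<le> (\<Sum>j\<in>I. W i j * (u i + u j)\<^sup>2)"
      using fin by (intro member_le_sum) (auto simp: W_def)
    then show "4 * (u i)\<^sup>2 \<le> (\<Sum>j\<in>I. W i j * (u i + u j)\<^sup>2)"
      by (simp add: W_def power2_eq_square)
  qed
  ultimately show ?thesis by (simp add: u_def y_def I_def)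
qed

text \<open>
  If the first agent hardly moves, then all its neighbours are close to it. The last of them, \<open>k\<close>, has the
  neighbour \<open>k + 1\<close> at distance almost 1, and no neighbour far to its left, so it moves.
\<close>

lemma ex_large_move:
  assumes mono: "mono_on {1..n} x" and act: "unsettled n x" and n: "1 \<le> n"
  shows "\<exists>i\<in>{1..n}. 1 / (4 * (real n)\<^sup>2) \<le> \<bar>hk_step n x i - x i\<bar>"
proof (rule ccontr)
  define \<delta> where "\<delta> = 1 / (4 * (real n)\<^sup>2)"
  assume "\<not> ?thesis"
  then have small: "\<bar>hk_step n x i - x i\<bar> < \<delta>" if "i \<in> {1..n}" for i
    using that by (force simp: \<delta>_def)
  have \<delta>: "0 < \<delta>" using n by (simp add: \<delta>_def)
  have total: "(\<Sum>j\<in>hk_nbrs n x i. x j - x i) \<le> n * \<delta>" if i: "i \<in> {1..n}" for i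
  proof -
    have "card (hk_nbrs n x i) \<le> card {1..n}"
      by (intro card_mono) (auto simp: hk_nbrs_def)
    then have "card (hk_nbrs n x i) * \<delta> \<le> n * \<delta>"
      using \<delta> by simp
    moreover have "card (hk_nbrs n x i) * (hk_step n x i - x i) \<le> card (hk_nbrs n x i) * \<delta>"
      using small[OF i] by (intro mult_left_mono) auto
    ultimately show ?thesis using sum_move_eq[OF i] by simp
  qed
  have le: "x a \<le> x b" if "1 \<le> a" "a \<le> b" "b \<le> n" for a b
    using mono that by (auto simp: mono_on_def)
  have near: "x j - x 1 \<le> n * \<delta>" if j: "j \<in> {1..n}" "x j - x 1 \<le> 1" for j
  proof -
    have "x j - x 1 \<le> (\<Sum>j\<in>hk_nbrs n x 1. x j - x 1)"
      using j le[of 1] n by (intro member_le_sum) (auto simp: hk_nbrs_def)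
    then show ?thesis using total[of 1] n by simp
  qed
  define k where "k = Max {j\<in>{1..n}. x j - x 1 \<le> 1}"
  have "1 \<in> {j\<in>{1..n}. x j - x 1 \<le> 1}" using n by simp
  then have "k \<in> {j\<in>{1..n}. x j - x 1 \<le> 1}"
    unfolding k_def by (intro Max_in) auto
  then have k: "k \<in> {1..n}" "x k - x 1 \<le> 1" by simp_all
  have k_ub: "j \<le> k" if "j \<in> {1..n}" "x j - x 1 \<le> 1" for j
    unfolding k_def using that by (intro Max_ge) auto
  have "k \<noteq> n" using k act by (auto simp: unsettled_def)
  then have Suc_k: "Suc k \<in> {1..n}" using k by auto
  have far: "1 < x (Suc k) - x 1" using k_ub[OF Suc_k] by force
  have adj: "x (Suc k) - x k \<le> 1"
    using act k \<open>k \<noteq> n\<close> by (force simp: unsettled_def hk_disconnected_def)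
  have in_nbrs: "Suc k \<in> hk_nbrs n x k"
    using Suc_k adj le[of k "Suc k"] k by (auto simp: hk_nbrs_def)
  have "(\<Sum>j\<in>hk_nbrs n x k - {Suc k}. - (n * \<delta>)) \<le> (\<Sum>j\<in>hk_nbrs n x k - {Suc k}. x j - x k)"
  proof (intro sum_mono)
    fix j assume "j \<in> hk_nbrs n x k - {Suc k}"
    then have "x 1 \<le> x j" using le[of 1 j] by (auto simp: hk_nbrs_def)
    then show "- (n * \<delta>) \<le> x j - x k" using near[OF k] by simp
  qed
  moreover have "card (hk_nbrs n x k - {Suc k}) * (n * \<delta>) \<le> n * (n * \<delta>)"
  proof (intro mult_right_mono)
    have "card (hk_nbrs n x k - {Suc k}) \<le> card {1..n}"
      by (intro card_mono) (auto simp: hk_nbrs_def)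
    then show "real (card (hk_nbrs n x k - {Suc k})) \<le> n" by simp
  qed (use \<delta> in simp)
  ultimately have "- (n * (n * \<delta>)) \<le> (\<Sum>j\<in>hk_nbrs n x k - {Suc k}. x j - x k)"
    by simp
  then have "(x (Suc k) - x k) - n * (n * \<delta>) \<le> n * \<delta>"
    using total[OF k(1)] by (simp add: sum.remove[OF finite_hk_nbrs in_nbrs])
  then have "1 < 2 * (n * \<delta>) + n * (n * \<delta>)"
    using near[OF k] far by linarith
  moreover have "n * (n * \<delta>) = 1 / 4"
    using n by (simp add: \<delta>_def power2_eq_square)
  moreover have "1 * (n * \<delta>) \<le> n * (n * \<delta>)"
    using n \<delta> by (intro mult_right_mono) auto
  ultimately show False by linarith
qed

lemma energy_hk_step_unsettled:
  assumes "mono_on {1..n} x" "unsettled n x" "1 \<le> n"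
  shows "energy n (hk_step n x) + 1 / (4 * real n ^ 4) \<le> energy n x"
proof -
  obtain i where i: "i \<in> {1..n}" "1 / (4 * (real n)\<^sup>2) \<le> \<bar>hk_step n x i - x i\<bar>"
    using ex_large_move[OF assms] by blast
  have "(1 / (4 * (real n)\<^sup>2))\<^sup>2 \<le> (hk_step n x i - x i)\<^sup>2"
    using power_mono[OF i(2), of 2] by simp
  also have "\<dots> \<le> (\<Sum>i\<in>{1..n}. (hk_step n x i - x i)\<^sup>2)"
    using i(1) by (intro member_le_sum) auto
  finally have "1 / (4 * real n ^ 4) \<le> 4 * (\<Sum>i\<in>{1..n}. (hk_step n x i - x i)\<^sup>2)"
    by (simp add: power_divide power_mult_distrib)
  then show ?thesis using energy_hk_step[of n x] by linarith
qed

lemma ex_settled: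
  assumes mono: "mono_on {1..n} x" and n: "1 \<le> n"
  shows "\<exists>t\<le>4 * n ^ 6. \<not> unsettled n (hk_state n x t)"
proof (rule ccontr)
  assume "\<not> ?thesis"
  then have act: "unsettled n (hk_state n x t)" if "t \<le> 4 * n ^ 6" for t
    using that by blast
  have "energy n (hk_state n x t) + t / (4 * real n ^ 4) \<le> (real n)\<^sup>2" if "t \<le> Suc (4 * n ^ 6)" for t
    using that
  proof (induction t)
    case 0
    then show ?case using energy_le by simp
  next
    case (Suc t)
    then show ?case
      using energy_hk_step_unsettled[OF mono_hk_state[OF mono] act n, of t]
      by (simp add: add_divide_distrib)
  qed
  from this[of "Suc (4 * n ^ 6)"] have "(1 + 4 * real n ^ 6) / (4 * real n ^ 4) \<le> (real n)\<^sup>2"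
    using energy_nonneg[of n "hk_state n x (Suc (4 * n ^ 6))"] by simp
  then show False
    using n by (simp add: field_simps flip: power_add)
qed

lemma hk_max_time_exists:
  assumes n: "1 \<le> n" and x0: "mono_on {1..n} x0" and lb: "enat k \<le> hk_time n x0"
  shows "\<exists>m\<ge>k. hk_max_time n m"
proof -
  define S where "S = {m. \<exists>x. mono_on {1..n} x \<and> hk_time n x = enat m}"
  have bound: "hk_time n x \<le> enat (Suc (4 * n ^ 6))" if "mono_on {1..n} x" for x
    using ex_settled[OF that n] hk_time_le_Suc[OF that] by blast
  have val: "\<exists>m\<in>S. hk_time n x = enat m" if "mono_on {1..n} x" for x
    using bound[OF that] that by (cases "hk_time n x") (auto simp: S_def)
  have "S \<subseteq> {..Suc (4 * n ^ 6)}" using bound by (force simp: S_def)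
  then have fin: "finite S" by (rule finite_subset) simp
  obtain m where m: "m \<in> S" "hk_time n x0 = enat m" using val[OF x0] by blast
  have "Max S \<in> S" using fin m(1) by (intro Max_in) auto
  then have "hk_max_time n (Max S)"
    using val Max_ge[OF fin] unfolding hk_max_time_def by (force simp: S_def)
  moreover have "k \<le> Max S" using Max_ge[OF fin m(1)] lb m(2) by simp
  ultimately show ?thesis by blast
qed

section \<open>Slow systems\<close>

definition opinions :: "int \<Rightarrow> int list \<Rightarrow> nat \<Rightarrow> real" where
  "opinions u X i = real_of_int (X ! (i - 1)) / u"

text \<open>
  The state with opinions \<open>X\<close> in units of \<open>1 / u\<close> becomes \<open>scaled_step L u X\<close> in units of \<open>1 / (L u)\<close>, provided that
  \<open>L\<close> is a common multiple of the sizes of all neighbourhoods.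
\<close>

definition scaled_step :: "int \<Rightarrow> int \<Rightarrow> int list \<Rightarrow> int list" where
  "scaled_step L u X =
     map (\<lambda>a. let Y = filter (\<lambda>b. \<bar>a - b\<bar> \<le> u) X in L div int (length Y) * sum_list Y) X"

definition sizes_divide :: "int \<Rightarrow> int \<Rightarrow> int list \<Rightarrow> bool" where
  "sizes_divide L u X =
     list_all (\<lambda>a. L mod int (length (filter (\<lambda>b. \<bar>a - b\<bar> \<le> u) X)) = 0) X"

definition moving :: "int \<Rightarrow> int list \<Rightarrow> bool" where
  "moving u X \<longleftrightarrow> hd X \<noteq> last X \<and> list_all2 (\<lambda>a b. b - a \<le> u) (butlast X) (tl X)"

fun moves :: "nat \<Rightarrow> int \<Rightarrow> int \<Rightarrow> int list \<Rightarrow> bool" where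
  "moves 0 L u X = True"
| "moves (Suc k) L u X =
     (moving u X \<and> sizes_divide L u X \<and> moves k L (L * u) (scaled_step L u X))"

lemma hk_step_opinions:
  assumes u: "0 < u" and L: "0 < L" "sizes_divide L u X" and x: "\<And>i. i \<in> {1..length X} \<Longrightarrow> x i = opinions u X i"
    and i: "i \<in> {1..length X}"
  shows "hk_step (length X) x i = opinions (L * u) (scaled_step L u X) i"
proof -
  define n where "n = length X"
  define a where "a = X ! (i - 1)"
  define J where "J = {j. j < n \<and> \<bar>a - X ! j\<bar> \<le> u}"
  have nbrs: "hk_nbrs n x i = Suc ` J"
  proof (intro set_eqI iffI)
    fix j assume "j \<in> hk_nbrs n x i"
    then have j: "j \<in> {1..n}" "\<bar>x i - x j\<bar> \<le> 1" by (auto simp: hk_nbrs_def)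
    then have "\<bar>real_of_int a / u - real_of_int (X ! (j - 1)) / u\<bar> \<le> 1"
      using x i by (simp add: n_def opinions_def a_def)
    then have "\<bar>a - X ! (j - 1)\<bar> \<le> u"
      using u by (simp add: field_simps flip: diff_divide_distrib of_int_diff of_int_abs)
    then show "j \<in> Suc ` J"
      using j by (intro image_eqI[of _ _ "j - 1"]) (auto simp: J_def)
  next
    fix j assume "j \<in> Suc ` J"
    then obtain k where k: "j = Suc k" "k < n" "\<bar>a - X ! k\<bar> \<le> u" by (auto simp: J_def)
    then have "\<bar>real_of_int a / u - real_of_int (X ! k) / u\<bar> \<le> 1"
      using u by (simp add: field_simps flip: diff_divide_distrib of_int_diff of_int_abs)
    then show "j \<in> hk_nbrs n x i"
      using k x i by (simp add: hk_nbrs_def n_def opinions_def a_def)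
  qed
  define Y where "Y = filter (\<lambda>b. \<bar>a - b\<bar> \<le> u) X"
  have "X = map ((!) X) [0..<n]" by (simp add: n_def map_nth)
  then have Y: "Y = map ((!) X) (filter (\<lambda>j. \<bar>a - X ! j\<bar> \<le> u) [0..<n])"
    unfolding Y_def by (metis (no_types, lifting) filter_map comp_apply filter_cong)
  have len: "length Y = card J"
    by (simp add: Y J_def length_filter_upt)
  have "real_of_int (sum_list Y) = (\<Sum>j\<in>J. real_of_int (X ! j))"
    by (simp add: Y J_def sum_list_filter_upt)
  then have "hk_step n x i = sum_list Y / (u * card J)"
    unfolding hk_step_def nbrs using x
    by (simp add: sum.reindex card_image J_def n_def opinions_def flip: sum_divide_distrib)
  moreover have "J \<noteq> {}" using nbrs self_in_hk_nbrs[of i n x] i by (auto simp: n_def)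
  then have "card J > 0" by (auto simp: card_gt_0_iff J_def)
  moreover have "L mod int (length Y) = 0"
    using L(2) i unfolding sizes_divide_def list_all_length Y_def a_def
    by (auto dest: spec[of _ "i - 1"])
  then have Lq: "real_of_int L = real_of_int (L div int (length Y)) * card J"
    using len by (metis mult.commute mod_0_imp_dvd dvd_mult_div_cancel of_int_mult of_int_of_nat_eq)
  moreover have "scaled_step L u X ! (i - 1) = L div int (length Y) * sum_list Y"
    using i by (auto simp: scaled_step_def Y_def a_def Let_def)
  moreover have "real_of_int (L div int (length Y)) \<noteq> 0"
    using Lq L by auto
  ultimately show ?thesis
    using u unfolding opinions_def n_def of_int_mult by (simp add: Lq)
qed

lemma moves_sound:
  assumes "moves k L u X" "0 < u" "0 < L" "X \<noteq> []" "\<And>i. i \<in> {1..length X} \<Longrightarrow> x i = opinions u X i" "t < k"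
  shows "\<not> hk_consensus (length X) (hk_state (length X) x t) \<and> \<not> hk_disconnected (length X) (hk_state (length X) x t)"
  using assms
proof (induction k arbitrary: u X x t)
  case 0
  then show ?case by simp
next
  case (Suc k)
  show ?case
  proof (cases t)
    case 0
    have "x 1 \<noteq> x (length X)"
      using Suc.prems by (auto simp: moving_def opinions_def hd_conv_nth last_conv_nth Suc_le_eq)
    then have "\<not> hk_consensus (length X) x"
      using Suc.prems(4) unfolding hk_consensus_def by (metis atLeastAtMost_iff One_nat_def Suc_leI le_refl length_greater_0_conv)
    moreover have "x (i + 1) - x i \<le> 1" if "i \<in> {1..<length X}" for i
    proof -
      have "X ! i - X ! (i - 1) \<le> u"
        using Suc.prems(1) that
        by (auto simp: moving_def list_all2_conv_all_nth nth_butlast nth_tl dest!: spec[of _ "i - 1"])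
      then have "real_of_int (X ! i) - real_of_int (X ! (i - 1)) \<le> u" by linarith
      moreover have "x (i + 1) - x i = (real_of_int (X ! i) - real_of_int (X ! (i - 1))) / u"
        using Suc.prems(5) that by (simp add: opinions_def diff_divide_distrib)
      ultimately show ?thesis
        using Suc.prems(2) by simp
    qed
    ultimately show ?thesis
      using 0 by (auto simp: hk_disconnected_def not_less)
  next
    case (Suc t')
    define Y where "Y = scaled_step L u X"
    have len: "length Y = length X" by (simp add: Y_def scaled_step_def)
    have "\<not> hk_consensus (length Y) (hk_state (length Y) (hk_step (length X) x) t') \<and>
      \<not> hk_disconnected (length Y) (hk_state (length Y) (hk_step (length X) x) t')"
    proof (rule Suc.IH)
      show "moves k L (L * u) Y" "0 < L * u" "0 < L" "t' < k"
        using Suc.prems(1-3,6) Suc by (simp_all add: Y_def)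
      show "Y \<noteq> []" using len Suc.prems(4) by auto
      show "hk_step (length X) x i = opinions (L * u) Y i" if "i \<in> {1..length Y}" for i
        unfolding Y_def using Suc.prems that len by (intro hk_step_opinions) simp_all
    qed
    then show ?thesis
      unfolding Suc hk_state_Suc_shift len .
  qed
qed

lemma hk_time_ge:
  assumes "moves k L u X" "0 < u" "0 < L" "length X = n" "1 \<le> n"
  shows "enat k \<le> hk_time n (opinions u X)"
  unfolding hk_time_def
proof (intro INF_greatest)
  fix t assume "t \<in> {t. hk_consensus n (hk_state n (opinions u X) t) \<or>
    hk_disconnected n (hk_state n (opinions u X) t)}"
  moreover have "X \<noteq> []" using assms(4,5) by auto
  ultimately have "\<not> t < k"
    using moves_sound[OF assms(1-3), of "opinions u X" t] assms(4) by blast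
  then show "enat k \<le> enat t" by simp
qed

lemma mono_opinions:
  assumes "sorted X" "0 < u" "length X = n"
  shows "mono_on {1..n} (opinions u X)"
  using assms by (auto simp: mono_on_def opinions_def divide_right_mono sorted_iff_nth_mono)

text \<open>
  The initial opinions were found by a search over lattices with small denominators. The factors 2, 6, 12, 60, 12
  and 84 are common multiples of the neighbourhood sizes that occur in these orbits.
\<close>

lemma moves_examples:
  "moves 1 2 1 [0, 1]"
  "moves 2 6 1 [0, 1, 2]"
  "moves 5 12 1 [0, 1, 2, 3]"
  "moves 7 60 4 [0, 3, 7, 11, 15]"
  "moves 9 12 6 [0, 4, 9, 14, 20, 26]"
  "moves 12 84 4 [0, 3, 7, 11, 14, 18, 22]"
  by code_simp+

section \<open>The tables for three to six agents\<close>

text \<open>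
  Reflecting the line turns a valid entry into a valid entry, so only one entry of each mirror pair is listed;
  the check runs over both.
\<close>

definition mirror_reach :: "nat list \<Rightarrow> nat list" where
  "mirror_reach g = rev (map (\<lambda>ns. length g - 1 - hd ns) (nbr_lists g))"

definition mirror_entry :: "nat \<Rightarrow> entry \<Rightarrow> entry" where
  "mirror_entry n = (\<lambda>(w, k, certs). (map mirror_reach w, k,
     map (map (map (\<lambda>(i, j, c). (n - 1 - j, n - 1 - i, c)))) certs))"

definition symmetrize :: "nat \<Rightarrow> entry list \<Rightarrow> entry list" where
  "symmetrize n tab = tab @ map (mirror_entry n) tab"

lemma hk_max_timeI:
  assumes "moves m L u X" "table_ok n tab" "([], k, certs) \<in> set tab" "m = Suc k"
    and "0 < u" "0 < L" "sorted X" "length X = n" "1 \<le> n"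
  shows "hk_max_time n m"
proof -
  have up: "hk_time n x \<le> enat m" if "mono_on {1..n} x" for x
    using hk_time_le_table[OF assms(2,9,3) that] assms(4) by simp
  have mono: "mono_on {1..n} (opinions u X)"
    using mono_opinions[OF assms(7,5,8)] .
  moreover have "enat m \<le> hk_time n (opinions u X)"
    using hk_time_ge[OF assms(1,5,6,8,9)] .
  ultimately show ?thesis
    unfolding hk_max_time_def using up by (blast intro: antisym)
qed

lemma table_ok2: "table_ok 2 [([], 0, [])]"
  by code_simp

text \<open>
  The certificates are solutions of the dual linear programs. For \<open>n = 4\<close>, for instance, the first entry says that
  after the reach list \<open>[2, 3, 3, 3]\<close> the state is settled: \<open>3 * (y\<^sub>3 - y\<^sub>0) = x\<^sub>3 - x\<^sub>0\<close> for the states \<open>x\<close>, \<open>y\<close> before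
  and after the step, and this equals \<open>(x\<^sub>3 - x\<^sub>1) + (x\<^sub>2 - x\<^sub>0) - (x\<^sub>2 - x\<^sub>1) \<le> 2\<close>.
\<close>

definition table3 :: "entry list" where
  "table3 = [
   ([[1, 2, 2]], 0, [[[(0, 2, 2)], [(1, 2, -1), (0, 1, -1)]]]),
   ([], 1, [])]"

definition table4 :: "entry list" where
  "table4 = [
   ([[2, 3, 3, 3]], 0, [[[(0, 3, 3)], [(1, 3, -1), (2, 1, -1), (0, 2, -1)]]]),
   ([[1, 3, 3, 3], [1, 3, 3, 3]], 0, [[[(0, 3, 72)], [], [(3, 2, -13), (1, 3, -26), (0, 1, -21)]]]),
   ([[1, 3, 3, 3]], 1, [[[(1, 3, 12)], [(3, 2, -1), (1, 3, -2), (0, 1, -3)]]]),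
   ([[1, 2, 3, 3], [1, 2, 3, 3], [1, 2, 3, 3]], 1, [[[(0, 2, 216)], [], [], [(2, 3, -46),
      (0, 1, -47), (1, 2, -78)]], [[(1, 3, 216)], [], [], [(2, 3, -47), (0, 1, -46), (1, 2, -78)]]]),
   ([[1, 2, 3, 3], [1, 2, 3, 3]], 2, []),
   ([[1, 2, 3, 3]], 3, []),
   ([], 4, [])]"

definition table5 :: "entry list" where
  "table5 = [
   ([[2, 3, 4, 4, 4]], 0, [[[(0, 4, 3)], [(2, 4, -1), (0, 2, -1), (1, 3, -1)]]]),
   ([[2, 4, 4, 4, 4]], 0, [[[(0, 4, 12)], [(4, 3, -3), (2, 1, -5), (0, 2, -4), (1, 4, -6)]]]),
   ([[3, 4, 4, 4, 4]], 0, [[[(0, 4, 4)], [(1, 4, -1), (2, 1, -1), (3, 2, -1), (0, 3, -1)]]]),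
   ([[1, 4, 4, 4, 4], [1, 3, 4, 4, 4]], 0, [[[(0, 4, 32)], [(1, 4, -20)], [(0, 1, -5), (3, 2, -3),
      (1, 3, -6)]]]),
   ([[1, 4, 4, 4, 4], [1, 4, 4, 4, 4]], 0, [[[(0, 4, 80)], [], [(3, 2, -11), (1, 4, -33),
      (0, 1, -24), (4, 3, -22)]]]),
   ([[2, 2, 4, 4, 4], [2, 2, 4, 4, 4]], 0, [[[(0, 4, 9)], [], [(1, 0, -2), (2, 4, -4), (0, 2, -4),
      (4, 3, -2)]]]),
   ([[2, 2, 4, 4, 4], [1, 2, 3, 4, 4], [1, 2, 3, 4, 4], [1, 2, 3, 4, 4], [1, 2, 3, 4, 4]], 0,
      [[[(0, 4, 3888)], [], [], [], [], [(3, 4, -625), (0, 1, -625), (2, 3, -1250),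
      (1, 2, -1250)]]]),
   ([[1, 4, 4, 4, 4]], 1, [[[(1, 4, 20)], [(3, 2, -1), (1, 4, -3), (0, 1, -4), (4, 3, -2)]]]),
   ([[2, 2, 4, 4, 4]], 1, [[[(0, 2, 15)], [(1, 0, -2), (2, 4, -6), (0, 2, -4), (4, 3, -3)]],
      [[(2, 4, 15)], [(4, 3, -2), (1, 0, -3), (0, 2, -6), (2, 4, -4)]]]),
   ([[1, 3, 4, 4, 4], [1, 3, 3, 4, 4]], 1, [[[(1, 4, 144)], [], [(0, 1, -27), (2, 1, -2),
      (3, 4, -27), (1, 3, -49)]]]),
   ([[1, 3, 4, 4, 4], [1, 3, 4, 4, 4]], 1, [[[(1, 4, 144)], [], [(2, 4, -22), (0, 1, -27),
      (3, 2, -35), (1, 3, -48)]]]),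
   ([[1, 2, 4, 4, 4], [1, 2, 4, 4, 4], [1, 2, 4, 4, 4]], 1, [[[(1, 4, 324)], [], [(1, 2, -228)],
      [(1, 2, -46), (1, 0, -1)]], [[(0, 2, 432)], [], [(1, 2, -327)], [(1, 2, -70), (0, 1, -2)]]]),
   ([[1, 2, 3, 4, 4], [1, 2, 3, 4, 4], [1, 2, 3, 4, 4], [1, 2, 3, 4, 4]], 1, [[[(1, 3, -9)],
      [(2, 4, 5), (0, 2, 5)], [], [], []], [[(0, 2, 1296)], [], [], [], [(3, 4, -164), (2, 3, -356),
      (1, 2, -394), (0, 1, -211)]], [[(2, 4, 1296)], [], [], [], [(3, 4, -211), (1, 2, -356),
      (2, 3, -394), (0, 1, -164)]]]),
   ([[1, 2, 4, 4, 4], [1, 2, 4, 4, 4], [1, 2, 3, 4, 4], [1, 2, 3, 4, 4]], 1, [[[(1, 4, 5832)], [],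
      [(2, 4, -3960)], [], [(4, 3, -238), (0, 1, -613), (1, 2, -750)]], [[(0, 2, 7776)], [],
      [(2, 4, -5634)], [], [(4, 3, -358), (0, 1, -913), (1, 2, -1110)]]]),
   ([[1, 3, 3, 4, 4]], 2, [[[(1, 3, 4)], [(3, 4, -1), (0, 1, -1), (1, 3, -1)]], [[(0, 2, 2),
      (2, 4, 2)], [(0, 1, -1), (3, 4, -1), (1, 3, -2)]]]),
   ([[1, 3, 4, 4, 4]], 2, [[[(2, 4, 12)], [(2, 4, -1), (3, 2, -2), (1, 3, -3)]], [[(1, 3, 4)],
      [(3, 2, -1), (2, 4, -1), (0, 1, -1), (1, 3, -1)]]]),
   ([[1, 2, 4, 4, 4], [1, 2, 4, 4, 4]], 2, [[[(2, 4, 144)], [], [(4, 3, -11), (2, 4, -22),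
      (0, 1, -12), (1, 2, -21)]], [[(1, 3, -3), (1, 4, 3)], [], []]]),
   ([[1, 2, 4, 4, 4], [1, 2, 3, 4, 4], [1, 2, 3, 4, 4]], 2, [[[(2, 4, 432)], [], [], [(0, 1, -26),
      (3, 4, -29), (1, 2, -56), (2, 3, -54)]], [[(1, 3, -2376)], [(0, 2, 1800)], [(2, 4, 750)],
      [(3, 4, -25), (1, 2, -50)]]]),
   ([[1, 2, 4, 4, 4]], 3, [[[(2, 4, 12)], [(4, 3, -1), (2, 4, -2), (1, 2, -3)]]]),
   ([[1, 2, 3, 4, 4], [1, 2, 3, 4, 4], [1, 2, 3, 4, 4]], 3, []),
   ([[1, 2, 3, 4, 4], [1, 2, 3, 4, 4]], 4, []),
   ([[1, 2, 3, 4, 4]], 5, []),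
   ([], 6, [])]"

definition table6 :: "entry list" where
  "table6 = [
   ([[2, 5, 5, 5, 5, 5]], 0, [[[(0, 5, 15)], [(4, 3, -3), (2, 1, -7), (0, 2, -5), (1, 5, -9),
      (5, 4, -6)]]]),
   ([[3, 3, 5, 5, 5, 5]], 0, [[[(0, 5, 4)], [(1, 0, -1), (2, 5, -2), (3, 2, -2), (0, 3, -2),
      (5, 4, -1)]]]),
   ([[3, 4, 5, 5, 5, 5]], 0, [[[(0, 5, 4)], [(2, 5, -1), (3, 2, -1), (0, 3, -1), (1, 4, -1)]]]),
   ([[3, 5, 5, 5, 5, 5]], 0, [[[(0, 5, 20)], [(5, 4, -4), (3, 2, -6), (1, 5, -8), (0, 3, -5),
      (2, 1, -7)]]]),
   ([[4, 5, 5, 5, 5, 5]], 0, [[[(0, 5, 5)], [(1, 5, -1), (2, 1, -1), (3, 2, -1), (4, 3, -1),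
      (0, 4, -1)]]]),
   ([[1, 5, 5, 5, 5, 5], [1, 4, 5, 5, 5, 5]], 0, [[[(0, 5, 100)], [], [(2, 5, -17), (0, 1, -31),
      (3, 2, -28), (4, 3, -39), (1, 4, -50)]]]),
   ([[1, 5, 5, 5, 5, 5], [1, 5, 5, 5, 5, 5]], 0, [[[(0, 5, 100)], [], [(3, 2, -11), (1, 5, -44),
      (0, 1, -30), (4, 3, -22), (5, 4, -33)]]]),
   ([[2, 2, 5, 5, 5, 5], [2, 2, 5, 5, 5, 5]], 0, [[[(0, 5, 144)], [], [(4, 3, -25), (1, 0, -34),
      (2, 5, -75), (0, 2, -68), (5, 4, -50)]]]),
   ([[2, 4, 4, 5, 5, 5], [2, 4, 4, 5, 5, 5]], 0, [[[(0, 5, 45)], [], [(3, 5, -11), (2, 1, -16),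
      (4, 3, -16), (0, 2, -11), (1, 4, -21)]]]),
   ([[1, 5, 5, 5, 5, 5], [1, 2, 5, 5, 5, 5], [1, 2, 5, 5, 5, 5]], 0, [[[(0, 5, 2000)], [],
      [(1, 2, -1670)], [(5, 4, -13), (1, 2, -298), (4, 3, -26), (3, 2, -39)]]]),
   ([[2, 3, 5, 5, 5, 5], [1, 3, 3, 5, 5, 5], [1, 3, 3, 5, 5, 5]], 0, [[[(0, 5, 10800)], [], [],
      [(2, 1, -607), (5, 4, -1788), (0, 1, -1965), (3, 5, -3576), (1, 3, -4529)]]]),
   ([[1, 5, 5, 5, 5, 5], [1, 3, 5, 5, 5, 5], [1, 3, 3, 5, 5, 5]], 0, [[[(0, 5, 8000)], [],
      [(0, 2, 126)], [(5, 4, -1128), (0, 1, -1853), (3, 5, -2256), (1, 3, -3216)]]]),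
   ([[1, 5, 5, 5, 5, 5], [1, 3, 5, 5, 5, 5], [1, 3, 4, 4, 5, 5]], 0, [[[(0, 5, 800)], [],
      [(2, 5, -344)], [(5, 4, -64), (1, 3, -230), (3, 2, -115), (0, 1, -179)]]]),
   ([[1, 5, 5, 5, 5, 5], [1, 3, 5, 5, 5, 5], [1, 3, 4, 5, 5, 5]], 0, [[[(0, 5, 4000)], [], [],
      [(3, 5, -504), (0, 1, -895), (3, 2, -733), (1, 3, -1601), (2, 4, -609)]]]),
   ([[1, 5, 5, 5, 5, 5], [1, 3, 5, 5, 5, 5], [1, 3, 5, 5, 5, 5]], 0, [[[(0, 5, 4000)], [], [],
      [(5, 4, -528), (0, 1, -895), (2, 5, -1056), (1, 3, -1622), (3, 2, -1339)]]]),
   ([[2, 2, 5, 5, 5, 5], [2, 2, 4, 5, 5, 5], [2, 2, 4, 4, 5, 5]], 0, [[[(0, 5, 21600)], [], [],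
      [(4, 3, -1923), (1, 0, -3932), (4, 5, -3285), (2, 4, -9381), (0, 2, -7864)]]]),
   ([[2, 2, 5, 5, 5, 5], [2, 2, 4, 5, 5, 5], [2, 2, 4, 5, 5, 5]], 0, [[[(0, 5, 21600)], [], [],
      [(3, 5, -3570), (1, 0, -3932), (0, 2, -7864), (4, 3, -6648), (2, 4, -9726)]]]),
   ([[2, 2, 3, 5, 5, 5], [1, 2, 3, 4, 5, 5], [1, 2, 3, 4, 5, 5], [1, 2, 3, 4, 5, 5]], 0,
      [[[(2, 3, -2376)], [], [(0, 2, 1197), (3, 5, 1197)], [], [(4, 3, -55), (3, 2, -148),
      (2, 1, -55)]]]),
   ([[1, 4, 5, 5, 5, 5]], 1, [[[(1, 5, 20)], [(2, 5, -5), (0, 1, -4), (3, 2, -6), (4, 3, -7),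
      (1, 4, -8)]]]),
   ([[1, 5, 5, 5, 5, 5]], 1, [[[(1, 5, 30)], [(3, 2, -1), (1, 5, -4), (0, 1, -5), (4, 3, -2),
      (5, 4, -3)]]]),
   ([[2, 2, 5, 5, 5, 5]], 1, [[[(2, 5, 12)], [(4, 3, -1), (1, 0, -2), (0, 2, -4), (2, 5, -3),
      (5, 4, -2)]], [[(1, 3, -3), (0, 3, 3)], []], [[(0, 2, 6)], [(1, 0, -1), (2, 5, -3),
      (0, 2, -2), (4, 3, -1), (5, 4, -2)]]]),
   ([[2, 3, 5, 5, 5, 5]], 1, [[[(1, 5, 4)], [(5, 4, -1), (0, 3, 1), (2, 5, -2), (0, 2, -2),
      (1, 3, -1)]], [[(0, 2, 6)], [(5, 4, -1), (2, 5, -2), (0, 2, -1), (1, 3, -1)]]]),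
   ([[2, 4, 4, 5, 5, 5]], 1, [[[(1, 4, 5)], [(4, 3, -1), (3, 5, -1), (2, 1, -1), (0, 2, -1),
      (1, 4, -1)]], [[(0, 2, 15)], [(0, 2, -2), (4, 3, -3), (2, 1, -4), (1, 4, -6)]], [[(3, 5, 15)],
      [(3, 5, -2), (2, 1, -3), (4, 3, -4), (1, 4, -6)]], [[(2, 5, -5), (1, 5, 5)], []],
      [[(0, 3, -5), (0, 4, 5)], []]]),
   ([[2, 4, 5, 5, 5, 5]], 1, [[[(0, 4, 15)], [(2, 5, -3), (2, 1, -4), (4, 3, -3), (0, 2, -5),
      (1, 4, -6)]], [[(2, 5, 12)], [(2, 5, -1), (0, 2, -2), (4, 3, -1), (1, 4, -2)]]]),
   ([[1, 3, 3, 5, 5, 5], [1, 3, 3, 5, 5, 5]], 1, [[[(2, 5, 36)], [], [(2, 1, -7), (0, 1, -3),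
      (3, 5, -16), (1, 3, -17), (5, 4, -8)]], [[(0, 2, 360)], [], [(5, 4, -24), (0, 1, -105),
      (3, 5, -48), (3, 2, -49), (1, 3, -146)]], [[(1, 4, -1440)], [(0, 2, 474), (2, 4, 1032)],
      [(1, 0, -33), (1, 3, -24)]], [[(1, 3, 1200)], [], [(2, 1, -47), (0, 1, -165), (3, 5, -296),
      (1, 3, -409), (5, 4, -148)]]]),
   ([[1, 3, 5, 5, 5, 5], [1, 3, 3, 5, 5, 5]], 1, [[[(1, 5, 96)], [(0, 2, 18)], [(5, 4, -16),
      (0, 1, -27), (3, 5, -32), (1, 3, -48)]]]),
   ([[1, 3, 5, 5, 5, 5], [1, 3, 4, 4, 5, 5]], 1, [[[(1, 5, 16)], [(2, 5, -12)], [(3, 2, -3),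
      (0, 1, -3), (1, 3, -3), (3, 5, 3)]]]),
   ([[1, 3, 5, 5, 5, 5], [1, 3, 4, 5, 5, 5]], 1, [[[(1, 5, 48)], [], [(3, 5, -7), (0, 1, -9),
      (3, 2, -7), (1, 3, -18), (2, 4, -7)]]]),
   ([[1, 3, 5, 5, 5, 5], [1, 3, 5, 5, 5, 5]], 1, [[[(1, 5, 16)], [], [(5, 4, -2), (0, 1, -3),
      (2, 5, -4), (1, 3, -6), (3, 2, -5)]]]),
   ([[2, 2, 4, 5, 5, 5], [2, 2, 4, 4, 5, 5]], 1, [[[(2, 5, 450)], [], [(4, 5, -90), (4, 3, -17),
      (0, 2, -156), (1, 0, -78), (2, 4, -199)]], [[(1, 3, -3), (0, 3, 3)], [], []], [[(0, 2, 900)],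
      [], [(4, 5, -45), (4, 3, -81), (0, 2, -208), (1, 0, -104), (2, 4, -207)]]]),
   ([[2, 2, 4, 5, 5, 5], [2, 2, 4, 5, 5, 5]], 1, [[[(2, 5, 450)], [], [(3, 5, -80), (1, 0, -78),
      (0, 2, -156), (4, 3, -142), (2, 4, -204)]], [[(0, 3, 3), (1, 3, -3)], [], []], [[(0, 2, 900)],
      [], [(3, 5, -90), (4, 3, -156), (1, 0, -104), (0, 2, -208), (2, 4, -222)]]]),
   ([[1, 2, 5, 5, 5, 5], [1, 2, 5, 5, 5, 5], [1, 2, 5, 5, 5, 5]], 1, [[[(1, 5, 8640)], [],
      [(1, 2, -6051)], [(0, 1, -31), (1, 2, -1169)]]]),
   ([[1, 3, 4, 4, 5, 5], [1, 3, 4, 4, 5, 5], [1, 3, 4, 4, 5, 5]], 1, [[[(0, 3, 64)], [], [],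
      [(4, 5, -5), (0, 1, -13), (3, 2, -18), (1, 3, -22), (2, 4, -14)]], [[(2, 5, 64)], [], [],
      [(0, 1, -5), (3, 2, -18), (4, 5, -13), (1, 3, -14), (2, 4, -22)]]]),
   ([[2, 2, 3, 5, 5, 5], [2, 2, 3, 5, 5, 5], [2, 2, 3, 5, 5, 5]], 1, [[[(0, 3, 432)], [],
      [(2, 3, -354)], [(1, 0, -1), (2, 3, -69), (0, 2, -2)]], [[(2, 5, 432)], [], [(2, 3, -358)],
      [(1, 0, -1), (2, 3, -67), (2, 1, -2)]]]),
   ([[1, 2, 3, 4, 5, 5], [1, 2, 3, 4, 5, 5], [1, 2, 3, 4, 5, 5], [1, 2, 3, 4, 5, 5]], 1,
      [[[(2, 4, -4455)], [(0, 2, 2106), (3, 5, 3591)], [], [], [(4, 3, -71), (3, 2, -104),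
      (2, 1, -71)]], [[(1, 3, -4455)], [(0, 2, 3591), (3, 5, 2106)], [], [], [(4, 3, -71),
      (3, 2, -104), (2, 1, -71)]], [[(0, 2, 1296)], [], [], [], [(4, 5, -72), (3, 4, -216),
      (0, 1, -211), (1, 2, -394), (2, 3, -364)]], [[(3, 5, 1296)], [], [], [], [(4, 5, -211),
      (1, 2, -216), (2, 3, -364), (3, 4, -394), (0, 1, -72)]]]),
   ([[1, 2, 5, 5, 5, 5], [1, 2, 5, 5, 5, 5], [1, 2, 4, 5, 5, 5], [1, 2, 4, 4, 5, 5]], 1,
      [[[(1, 5, 34560)], [], [], [(1, 2, -19964)], [(3, 2, -1801), (1, 2, -4972), (2, 4, -4478),
      (4, 5, -3819)]]]),
   ([[1, 2, 5, 5, 5, 5], [1, 2, 5, 5, 5, 5], [1, 2, 4, 5, 5, 5], [1, 2, 4, 5, 5, 5]], 1,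
      [[[(1, 5, 103680)], [], [], [(1, 2, -78672)], [(1, 0, -6260), (4, 3, -6537), (1, 2, -7091),
      (3, 5, -13074)]]]),
   ([[1, 3, 3, 5, 5, 5]], 2, [[[(2, 4, -3), (2, 5, 3)], []], [[(3, 5, 15)], [(5, 4, -2), (0, 2, 3),
      (0, 1, -3), (3, 5, -4), (1, 3, -6)]], [[(1, 3, 20)], [(2, 1, -1), (3, 5, -8), (0, 1, -5),
      (5, 4, -4), (1, 3, -7)]]]),
   ([[1, 3, 4, 5, 5, 5]], 2, [[[(2, 5, 12)], [(2, 1, -2), (3, 5, -4), (1, 3, -5), (2, 4, -1)]],
      [[(1, 3, 20)], [(3, 5, -4), (0, 1, -5), (3, 2, -3), (1, 3, -6), (2, 4, -4)]]]),
   ([[1, 3, 5, 5, 5, 5]], 2, [[[(2, 5, 20)], [(5, 4, -1), (2, 5, -2), (3, 2, -3), (1, 3, -4)]],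
      [[(1, 3, 20)], [(5, 4, -4), (2, 5, -8), (0, 1, -5), (3, 2, -7), (1, 3, -6)]]]),
   ([[1, 4, 4, 4, 5, 5]], 2, [[[(1, 4, 5)], [(4, 5, -1), (0, 1, -1), (1, 4, -1)]], [[(3, 5, -4),
      (2, 5, 4)], []], [[(0, 2, -4), (0, 3, 4)], []], [[(3, 5, 4), (0, 2, 4)], [(4, 5, -2),
      (0, 1, -2), (1, 4, -4)]]]),
   ([[1, 4, 4, 5, 5, 5]], 2, [[[(2, 5, 12)], [(2, 1, -3), (3, 5, -4), (4, 3, -5), (1, 4, -6)]],
      [[(1, 4, 5)], [(3, 5, -1), (0, 1, -1), (4, 3, -1), (1, 4, -1)]]]),
   ([[2, 2, 4, 5, 5, 5]], 2, [[[(0, 4, 12), (1, 3, -12)], []], [[(0, 2, 15)], [(1, 0, -2),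
      (0, 2, -4), (4, 3, -3), (2, 4, -6)]], [[(3, 5, 12)], [(3, 5, -1), (4, 3, -2), (2, 4, -3)]],
      [[(2, 4, 20)], [(3, 5, -5), (4, 3, -6), (1, 0, -4), (0, 2, -8), (2, 4, -7)]]]),
   ([[2, 3, 4, 5, 5, 5]], 2, [[[(1, 4, 4)], [(3, 5, -1), (0, 2, -1), (1, 3, -1), (2, 4, -1)]],
      [[(0, 2, 15)], [(2, 4, -3), (2, 1, -1), (0, 2, -2), (1, 3, -3)]], [[(3, 5, 15)], [(2, 1, -1),
      (2, 4, -2), (1, 3, -4), (3, 5, -2)]]]),
   ([[1, 2, 5, 5, 5, 5], [1, 2, 5, 5, 5, 5]], 2, [[[(2, 5, 1200)], [], [(4, 3, -57), (1, 2, -148),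
      (2, 5, -171), (0, 1, -80), (5, 4, -114)]], [[(1, 3, -4), (1, 4, 4)], [], []]]),
   ([[1, 3, 4, 4, 5, 5], [1, 3, 4, 4, 5, 5]], 2, [[[(3, 5, -4), (2, 5, 4)], [], []], [[(0, 2, -4),
      (0, 3, 4)], [], []], [[(1, 3, 16)], [], [(4, 5, -1), (0, 1, -2), (3, 2, -3), (1, 3, -4),
      (2, 4, -2)]], [[(2, 4, 16)], [], [(0, 1, -1), (3, 2, -3), (4, 5, -2), (1, 3, -2),
      (2, 4, -4)]], [[(1, 4, -8), (0, 2, 4), (3, 5, 4)], [], []]]),
   ([[2, 2, 3, 5, 5, 5], [2, 2, 3, 5, 5, 5]], 2, [[[(2, 4, -3), (2, 5, 3)], [], []], [[(0, 2, 144)],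
      [], [(5, 4, -9), (1, 0, -11), (3, 5, -18), (0, 2, -22), (2, 3, -24)]], [[(3, 5, 144)], [],
      [(5, 4, -11), (1, 0, -9), (3, 5, -22), (0, 2, -18), (2, 3, -24)]], [[(1, 3, -3), (0, 3, 3)],
      [], []]]),
   ([[1, 2, 5, 5, 5, 5], [1, 2, 4, 5, 5, 5], [1, 2, 4, 4, 5, 5]], 2, [[[(2, 5, 2880)], [], [],
      [(4, 3, -70), (0, 1, -148), (4, 5, -99), (1, 2, -317), (2, 4, -299)]], [[(1, 3, -4),
      (1, 4, 4)], [], [], []]]),
   ([[1, 2, 5, 5, 5, 5], [1, 2, 4, 5, 5, 5], [1, 2, 4, 5, 5, 5]], 2, [[[(2, 5, 2880)], [], [],
      [(3, 5, -118), (0, 1, -148), (1, 2, -317), (4, 3, -215), (2, 4, -312)]], [[(1, 3, -1728)], [],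
      [(2, 5, 1680)], [(1, 0, -5), (0, 2, 407), (3, 5, -278), (4, 3, -139)]]]),
   ([[1, 2, 3, 5, 5, 5], [1, 2, 3, 5, 5, 5], [1, 2, 3, 5, 5, 5], [1, 2, 3, 4, 5, 5]], 2,
      [[[(2, 5, 1620)], [], [(2, 3, -1476)], [], [(3, 5, 44), (0, 1, -51), (1, 2, -126),
      (5, 4, -26)]], [[(0, 2, 19440)], [], [(2, 3, -14868)], [], [(4, 3, -1432), (1, 2, -2538),
      (5, 4, -1410), (0, 1, -1573)]]]),
   ([[1, 2, 3, 5, 5, 5], [1, 2, 3, 5, 5, 5], [1, 2, 3, 5, 5, 5], [1, 2, 3, 5, 5, 5]], 2,
      [[[(2, 5, 972)], [], [], [(2, 3, -555)], [(0, 1, -129), (1, 2, -112), (2, 3, -146)]],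
      [[(0, 2, 1296)], [], [], [(2, 3, -555)], [(1, 2, -232), (0, 1, -215), (2, 3, -198)]]]),
   ([[1, 2, 5, 5, 5, 5]], 3, [[[(2, 5, 20)], [(4, 3, -1), (2, 5, -3), (1, 2, -4), (5, 4, -2)]]]),
   ([[1, 3, 4, 4, 5, 5]], 3, [[[(1, 3, 4)], [(3, 2, -1), (2, 4, -1), (0, 1, -1), (1, 3, -1)]],
      [[(2, 4, 4)], [(3, 2, -1), (2, 4, -1), (4, 5, -1), (1, 3, -1)]]]),
   ([[2, 2, 3, 5, 5, 5]], 3, [[[(0, 2, 12)], [(1, 0, -1), (0, 2, -2), (2, 3, -3)]], [[(3, 5, 12)],
      [(5, 4, -1), (3, 5, -2), (2, 3, -3)]]]),
   ([[1, 2, 4, 5, 5, 5], [1, 2, 4, 4, 5, 5]], 3, [[[(2, 5, 144)], [], [(3, 2, -2), (4, 5, -27),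
      (0, 1, -12), (1, 2, -33), (2, 4, -49)]]]),
   ([[1, 2, 4, 5, 5, 5], [1, 2, 4, 5, 5, 5]], 3, [[[(2, 5, 144)], [], [(3, 5, -22), (0, 1, -12),
      (1, 2, -33), (4, 3, -35), (2, 4, -48)]]]),
   ([[1, 2, 4, 5, 5, 5]], 4, [[[(3, 5, 12)], [(3, 5, -1), (4, 3, -2), (2, 4, -3)]], [[(2, 4, 4)],
      [(4, 3, -1), (3, 5, -1), (1, 2, -1), (2, 4, -1)]]]),
   ([[1, 2, 4, 4, 5, 5], [1, 2, 4, 4, 5, 5]], 4, [[[(2, 4, 24)], [], [(1, 2, -4), (4, 5, -3),
      (0, 1, -2), (2, 4, -6)]], [[(3, 5, 72)], [], [(3, 2, -11), (4, 5, -21), (1, 2, -6),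
      (2, 4, -28)]]]),
   ([[1, 2, 3, 5, 5, 5], [1, 2, 3, 5, 5, 5], [1, 2, 3, 4, 5, 5]], 4, [[[(3, 5, 324)], [(2, 3, -99)],
      [], [(1, 0, -2), (3, 4, -2)]], [[(2, 5, 3), (2, 4, -3)], [], [], []]]),
   ([[1, 2, 3, 5, 5, 5], [1, 2, 3, 5, 5, 5], [1, 2, 3, 5, 5, 5]], 4, [[[(3, 5, 1728)], [], [],
      [(3, 5, -170), (1, 2, -132), (0, 1, -48), (2, 3, -219), (5, 4, -85)]], [[(2, 4, -3),
      (2, 5, 3)], [], [], []]]),
   ([[1, 2, 3, 5, 5, 5], [1, 2, 3, 4, 5, 5], [1, 2, 3, 4, 5, 5], [1, 2, 3, 4, 5, 5]], 4,
      [[[(0, 2, 1296)], [], [], [], [(0, 1, -211), (3, 4, -216), (4, 5, -72), (1, 2, -394),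
      (2, 3, -364)]], [[(3, 5, 2592)], [], [], [], [(3, 4, -278), (1, 2, -200), (2, 3, -284),
      (4, 5, -137), (0, 1, -76)]]]),
   ([[1, 2, 4, 4, 5, 5]], 5, [[[(2, 4, 4)], [(1, 2, -1), (4, 5, -1), (2, 4, -1)]]]),
   ([[1, 2, 3, 5, 5, 5], [1, 2, 3, 4, 5, 5]], 5, [[[(3, 5, 72)], [], [(2, 3, -10), (1, 2, -6),
      (4, 5, -5), (3, 4, -12)]]]),
   ([[1, 2, 3, 5, 5, 5], [1, 2, 3, 5, 5, 5]], 5, [[[(3, 5, 144)], [], [(5, 4, -11), (3, 5, -22),
      (2, 3, -21), (1, 2, -12)]]]),
   ([[1, 2, 3, 4, 5, 5], [1, 2, 3, 4, 5, 5], [1, 2, 3, 4, 5, 5]], 5, [[[(2, 4, -297)], [(0, 2, 126),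
      (3, 5, 225)], [], [(4, 3, -11), (3, 2, -26), (2, 1, -11)]], [[(1, 3, -297)], [(0, 2, 225),
      (3, 5, 126)], [], [(4, 3, -11), (3, 2, -26), (2, 1, -11)]]]),
   ([[1, 2, 3, 5, 5, 5]], 6, [[[(3, 5, 12)], [(5, 4, -1), (3, 5, -2), (2, 3, -3)]]]),
   ([[1, 2, 3, 4, 5, 5], [1, 2, 3, 4, 5, 5]], 6, []),
   ([[1, 2, 3, 4, 5, 5]], 7, []),
   ([], 8, [])]"

lemma tables_ok: "table_ok 3 (symmetrize 3 table3)" "table_ok 4 (symmetrize 4 table4)" "table_ok 5 (symmetrize 5 table5)"
  by code_simp+

lemma table_ok6: "table_ok 6 (symmetrize 6 table6)"
  by code_simp

theorem mainTheorem1: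
  shows "hk_max_time 1 0 \<and> hk_max_time 2 1 \<and> hk_max_time 3 2 \<and> hk_max_time 4 5 \<and>
    hk_max_time 5 7 \<and> hk_max_time 6 9 \<and> (\<exists>m\<ge>12. hk_max_time 7 m)"
proof (intro conjI)
  have "hk_consensus 1 x" for x by (simp add: hk_consensus_def)
  then have "hk_time 1 x = 0" for x
    using hk_time_le[of 1 x 0 0] by (simp flip: zero_enat_def)
  then show "hk_max_time 1 0"
    by (auto simp: hk_max_time_def zero_enat_def mono_on_def)
  show "hk_max_time 2 1"
    by (rule hk_max_timeI[OF moves_examples(1) table_ok2]) simp_all
  show "hk_max_time 3 2"
    by (rule hk_max_timeI[OF moves_examples(2) tables_ok(1), where k = 1 and certs = "[]"])
      (simp_all add: symmetrize_def table3_def)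
  show "hk_max_time 4 5"
    by (rule hk_max_timeI[OF moves_examples(3) tables_ok(2), where k = 4 and certs = "[]"])
      (simp_all add: symmetrize_def table4_def)
  show "hk_max_time 5 7"
    by (rule hk_max_timeI[OF moves_examples(4) tables_ok(3), where k = 6 and certs = "[]"])
      (simp_all add: symmetrize_def table5_def)
  show "hk_max_time 6 9"
    by (rule hk_max_timeI[OF moves_examples(5) table_ok6, where k = 8 and certs = "[]"])
      (simp_all add: symmetrize_def table6_def)
  show "\<exists>m\<ge>12. hk_max_time 7 m"
  proof (rule hk_max_time_exists)
    show "enat 12 \<le> hk_time 7 (opinions 4 [0, 3, 7, 11, 14, 18, 22])"
      by (rule hk_time_ge[OF moves_examples(6)]) simp_all
    show "mono_on {1..7} (opinions 4 [0, 3, 7, 11, 14, 18, 22])"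
      by (rule mono_opinions) simp_all
  qed simp
qed

end
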